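(* Let $\Omega_1\subset\mathbb{R}^{N_1}$ and $\Omega_2\subset\mathbb{R}^{N_2}$ be regions satisfying (B1), and let $\Omega_p:=\Omega_1\times\Omega_2$. Let $\{\lambda_{1j}\}_{j\in\mathbb{N}}$, $\mathcal{E}_1=\{e_{1j}\}_{j\in\mathbb{N}}$ and $\{\lambda_{2k}\}_{k\in\mathbb{N}}$, $\mathcal{E}_2=\{e_{2k}\}_{k\in\mathbb{N}}$ be the sequences of Dirichlet Laplacian eigenvalues and eigenfunctions on $\Omega_1$ and $\Omega_2$ respectively. Then for all $j,k\in\mathbb{N}$ the function $u_{jk}:=e_{1j}\otimes e_{2k}$ is a Dirichlet Laplacian eigenfunction on the product region $\Omega_p$ corresponding to the eigenvalue $\lambda_{1j}+\lambda_{2k}$.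
   Context: A region is a nonempty, connected, open subset of $\mathbb{R}^N$. Condition (B1) on a region $\Omega\subset\mathbb{R}^N$: $\Omega$ is bounded and its boundary $\partial\Omega:=\overline{\Omega}\setminus\Omega$ is the union of a finite number of disjoint closed Lipschitz surfaces, each having finite surface area. All function spaces are real. The Dirichlet Laplacian eigenproblem on a region $\Omega$ is to find $(\lambda,u)\in\mathbb{R}\times H_0^1(\Omega)$ with $u\neq 0$ such that $\int_\Omega\nabla u\cdot\nabla h\,dx=\lambda\int_\Omega u\,h\,dx$ for all $h\in H_0^1(\Omega)$; then $\lambda$ is a Dirichlet Laplacian eigenvalue and $u$ an associated eigenfunction. The sequences of Dirichlet eigendata on $\Omega$ are $\{\lambda_j:j\in\mathbb{N}\}$, the strictly positive eigenvalues repeated according to multiplicity with $\lambda_j\to\infty$, and an associated sequence of eigenfunctions $\{e_j:j\in\mathbb{N}\}$ forming an orthonormal basis of $L^2(\Omega)$, such that $\{\lambda_j^{-1/2}e_j\}$ is an orthonormal basis of $H_0^1(\Omega)$ with respect to the inner product $[u,v]_\nabla:=\int_\Omega\nabla u\cdot\nabla v\,dx$. For functions $e$ on $\Omega_1$ and $f$ on $\Omega_2$, $(e\otimes f)(x,y):=e(x)f(y)$ for $(x,y)\in\Omega_1\times\Omega_2$. *)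

theory Defs
  imports "HOL-Analysis.Analysis"
begin

text \<open>
  Euclidean spaces are types of class \<open>euclidean_space\<close>; \<open>'a \<times> 'b\<close> is then Euclidean of dimension
  \<open>DIM('a) + DIM('b)\<close>. A function on \<open>\<Omega> \<subseteq> 'a\<close> is represented by a total function on \<open>'a\<close>
  of which only the values on \<open>\<Omega>\<close> matter, and up to null sets.
\<close>

section \<open>Regions and condition (B1)\<close>

definition region :: "'a::euclidean_space set \<Rightarrow> bool" where
  "region \<Omega> \<longleftrightarrow> \<Omega> \<noteq> {} \<and> connected \<Omega> \<and> open \<Omega>"

lemma region_Times: "region \<Omega>1 \<Longrightarrow> region \<Omega>2 \<Longrightarrow> region (\<Omega>1 \<times> \<Omega>2)"
  by (auto simp: region_def open_Times connected_Times)

text \<open>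
  Surface area is the \<open>(N-1)\<close>-dimensional Hausdorff measure, with the usual normalisation. Empty
  covering sets are given weight \<open>0\<close> because \<open>0 ^ 0 = 1\<close>; the boundedness requirement is needed
  because \<^const>\<open>diameter\<close> is meaningless on unbounded sets.
\<close>

definition hausdorff_pre :: "nat \<Rightarrow> real \<Rightarrow> 'a::euclidean_space set \<Rightarrow> ennreal" where
  "hausdorff_pre m \<delta> S =
     (INF C \<in> {C :: nat \<Rightarrow> 'a set. S \<subseteq> (\<Union>i. C i) \<and> (\<forall>i. bounded (C i) \<and> diameter (C i) \<le> \<delta>)}.
        \<Sum>i. if C i = {} then 0 else ennreal (unit_ball_vol (real m) * (diameter (C i) / 2) ^ m))"

definition hausdorff_measure :: "nat \<Rightarrow> 'a::euclidean_space set \<Rightarrow> ennreal" where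
  "hausdorff_measure m S = (SUP \<delta> \<in> {0<..}. hausdorff_pre m \<delta> S)"

definition surface_area :: "'a::euclidean_space set \<Rightarrow> ennreal" where
  "surface_area S = hausdorff_measure (DIM('a) - 1) S"

text \<open>
  A closed Lipschitz surface is a compact connected set which, near each of its points, is the graph
  of a real Lipschitz function \<open>\<gamma>\<close> over the hyperplane orthogonal to some unit vector \<open>n\<close>
  (so that it has no edge).
\<close>

definition closed_lipschitz_surface :: "'a::euclidean_space set \<Rightarrow> bool" where
  "closed_lipschitz_surface S \<longleftrightarrow>
     S \<noteq> {} \<and> compact S \<and> connected S \<and>
     (\<forall>p\<in>S. \<exists>U n L (\<gamma> :: 'a \<Rightarrow> real).
        open U \<and> p \<in> U \<and> norm n = 1 \<and> L-lipschitz_on {y. y \<bullet> n = 0} \<gamma> \<and>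
        S \<inter> U = {x \<in> U. x \<bullet> n = \<gamma> (x - (x \<bullet> n) *\<^sub>R n)})"

definition condition_B1 :: "'a::euclidean_space set \<Rightarrow> bool" where
  "condition_B1 \<Omega> \<longleftrightarrow>
     bounded \<Omega> \<and>
     (\<exists>F. finite F \<and> pairwise disjnt F \<and>
          (\<forall>S\<in>F. closed_lipschitz_surface S \<and> surface_area S < \<infinity>) \<and>
          closure \<Omega> - \<Omega> = \<Union>F)"

section \<open>The Sobolev space \<open>H\<^sub>0\<^sup>1(\<Omega>)\<close>\<close>

text \<open>Square-integrable functions, with values in \<open>\<real>\<close> or (for gradients) in \<open>'a\<close>.\<close>

definition L2 :: "'a::euclidean_space set \<Rightarrow> ('a \<Rightarrow> 'b::euclidean_space) set" where
  "L2 \<Omega> = {u \<in> borel_measurable (lebesgue_on \<Omega>). integrable (lebesgue_on \<Omega>) (\<lambda>x. (norm (u x))\<^sup>2)}"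

definition L2_inner :: "'a::euclidean_space set \<Rightarrow> ('a \<Rightarrow> 'b::euclidean_space) \<Rightarrow> ('a \<Rightarrow> 'b) \<Rightarrow> real" where
  "L2_inner \<Omega> u v = (LINT x|lebesgue_on \<Omega>. u x \<bullet> v x)"

fun C_k :: "nat \<Rightarrow> ('a::euclidean_space \<Rightarrow> real) \<Rightarrow> bool" where
  "C_k 0 f \<longleftrightarrow> continuous_on UNIV f"
| "C_k (Suc k) f \<longleftrightarrow> f differentiable_on UNIV \<and>
     (\<forall>b\<in>Basis. C_k k (\<lambda>x. frechet_derivative f (at x) b))"

definition test_functions :: "'a::euclidean_space set \<Rightarrow> ('a \<Rightarrow> real) set" where
  "test_functions \<Omega> =
     {\<phi>. (\<forall>k. C_k k \<phi>) \<and> compact (closure {x. \<phi> x \<noteq> 0}) \<and> closure {x. \<phi> x \<noteq> 0} \<subseteq> \<Omega>}"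

definition has_weak_gradient ::
    "'a::euclidean_space set \<Rightarrow> ('a \<Rightarrow> real) \<Rightarrow> ('a \<Rightarrow> 'a) \<Rightarrow> bool" where
  "has_weak_gradient \<Omega> u g \<longleftrightarrow>
     u \<in> L2 \<Omega> \<and> g \<in> L2 \<Omega> \<and>
     (\<forall>\<phi>\<in>test_functions \<Omega>. \<forall>b\<in>Basis.
        (LINT x|lebesgue_on \<Omega>. u x * frechet_derivative \<phi> (at x) b) =
        - (LINT x|lebesgue_on \<Omega>. (g x \<bullet> b) * \<phi> x))"

definition H1 :: "'a::euclidean_space set \<Rightarrow> ('a \<Rightarrow> real) set" where
  "H1 \<Omega> = {u. \<exists>g. has_weak_gradient \<Omega> u g}"

text \<open>For \<open>u \<in> H1 \<Omega>\<close> with \<open>\<Omega>\<close> open, the weak gradient is determined almost everywhere on \<open>\<Omega>\<close>.\<close>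

definition weak_gradient :: "'a::euclidean_space set \<Rightarrow> ('a \<Rightarrow> real) \<Rightarrow> 'a \<Rightarrow> 'a" where
  "weak_gradient \<Omega> u = (SOME g. has_weak_gradient \<Omega> u g)"

definition grad_inner :: "'a::euclidean_space set \<Rightarrow> ('a \<Rightarrow> real) \<Rightarrow> ('a \<Rightarrow> real) \<Rightarrow> real" where
  "grad_inner \<Omega> u v = L2_inner \<Omega> (weak_gradient \<Omega> u) (weak_gradient \<Omega> v)"

definition H1_norm :: "'a::euclidean_space set \<Rightarrow> ('a \<Rightarrow> real) \<Rightarrow> real" where
  "H1_norm \<Omega> u = sqrt (L2_inner \<Omega> u u + grad_inner \<Omega> u u)"

definition H01 :: "'a::euclidean_space set \<Rightarrow> ('a \<Rightarrow> real) set" where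
  "H01 \<Omega> = {u \<in> H1 \<Omega>. \<forall>\<epsilon>>0. \<exists>\<phi>\<in>test_functions \<Omega>. H1_norm \<Omega> (\<lambda>x. u x - \<phi> x) < \<epsilon>}"

section \<open>Dirichlet Laplacian eigendata\<close>

definition dirichlet_eigenfunction :: "'a::euclidean_space set \<Rightarrow> real \<Rightarrow> ('a \<Rightarrow> real) \<Rightarrow> bool" where
  "dirichlet_eigenfunction \<Omega> \<mu> u \<longleftrightarrow>
     u \<in> H01 \<Omega> \<and> \<not> (AE x in lebesgue_on \<Omega>. u x = 0) \<and>
     (\<forall>h\<in>H01 \<Omega>. grad_inner \<Omega> u h = \<mu> * L2_inner \<Omega> u h)"

text \<open>
  \<open>m\<close> is the dimension of the eigenspace of \<open>\<mu>\<close> (functions being identified almost everywhere):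
  \<open>b 0, \<dots>, b (m - 1)\<close> is a basis. If \<open>\<mu>\<close> is not an eigenvalue, this holds for \<open>m = 0\<close> only.
\<close>

definition has_multiplicity :: "'a::euclidean_space set \<Rightarrow> real \<Rightarrow> nat \<Rightarrow> bool" where
  "has_multiplicity \<Omega> \<mu> m \<longleftrightarrow>
     (\<exists>b :: nat \<Rightarrow> 'a \<Rightarrow> real.
        (\<forall>i<m. dirichlet_eigenfunction \<Omega> \<mu> (b i)) \<and>
        (\<forall>c. (AE x in lebesgue_on \<Omega>. (\<Sum>i<m. c i * b i x) = 0) \<longrightarrow> (\<forall>i<m. c i = 0)) \<and>
        (\<forall>u. dirichlet_eigenfunction \<Omega> \<mu> u \<longrightarrow>
              (\<exists>c. AE x in lebesgue_on \<Omega>. u x = (\<Sum>i<m. c i * b i x))))"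

definition orthonormal_basis ::
    "('a \<Rightarrow> real) set \<Rightarrow> (('a \<Rightarrow> real) \<Rightarrow> ('a \<Rightarrow> real) \<Rightarrow> real) \<Rightarrow> (nat \<Rightarrow> 'a \<Rightarrow> real) \<Rightarrow> bool" where
  "orthonormal_basis X ip e \<longleftrightarrow>
     (\<forall>j. e j \<in> X) \<and>
     (\<forall>j k. ip (e j) (e k) = (if j = k then 1 else 0)) \<and>
     (\<forall>u\<in>X. (\<lambda>n. let r = (\<lambda>x. u x - (\<Sum>j<n. ip u (e j) * e j x)) in sqrt (ip r r)) \<longlonglongrightarrow> 0)"

definition dirichlet_eigendata ::
    "'a::euclidean_space set \<Rightarrow> (nat \<Rightarrow> real) \<Rightarrow> (nat \<Rightarrow> 'a \<Rightarrow> real) \<Rightarrow> bool" where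
  "dirichlet_eigendata \<Omega> lam e \<longleftrightarrow>
     (\<forall>j. lam j > 0) \<and>
     (\<forall>\<mu>>0. finite {j. lam j = \<mu>} \<and> has_multiplicity \<Omega> \<mu> (card {j. lam j = \<mu>})) \<and>
     filterlim lam at_top sequentially \<and>
     (\<forall>j. dirichlet_eigenfunction \<Omega> (lam j) (e j)) \<and>
     orthonormal_basis (L2 \<Omega>) (L2_inner \<Omega>) e \<and>
     orthonormal_basis (H01 \<Omega>) (grad_inner \<Omega>) (\<lambda>j x. lam j powr (-1/2) * e j x)"

definition tensor :: "('a \<Rightarrow> real) \<Rightarrow> ('b \<Rightarrow> real) \<Rightarrow> 'a \<times> 'b \<Rightarrow> real" where
  "tensor e f = (\<lambda>(x, y). e x * f y)"

end

theory Submission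
  imports Defs
begin

text \<open>
  Classically the claim is the product rule
  \<open>- \<Delta> (e f) = (- \<Delta> e) f + e (- \<Delta> f) = (\<mu> + \<nu>) e f\<close>, and the weak form follows the same line. Let
  \<open>\<Phi>\<close> be a test function on \<open>A \<times> B\<close>. For fixed \<open>y\<close> the slice \<open>\<Phi>(\<cdot>, y)\<close> is a test function on \<open>A\<close>, so the
  weak equation of \<open>e\<close> applies to it; multiplying by \<open>f y\<close>, integrating over \<open>y\<close>, doing the same in the other
  variable and adding gives the weak equation of \<open>e \<otimes> f\<close> against \<open>\<Phi>\<close> with eigenvalue \<open>\<mu> + \<nu>\<close>
  (\<open>weak_equation_tensor\<close>). Both sides are continuous in \<open>\<Phi>\<close> for the \<open>H\<^sup>1\<close> norm, and test functions are dense
  in \<open>H\<^sub>0\<^sup>1\<close> by definition, so the equation holds against all of \<open>H\<^sub>0\<^sup>1(A \<times> B)\<close> (\<open>weak_equation_density\<close>).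

  Membership of \<open>e \<otimes> f\<close> in \<open>H\<^sub>0\<^sup>1(A \<times> B)\<close> is again Fubini: integrating by parts slice by slice shows that
  \<open>(f \<nabla>e, e \<nabla>f)\<close> is a weak gradient (\<open>has_weak_gradient_tensor\<close>), and if test functions \<open>\<phi>\<close> and \<open>\<psi>\<close> approximate
  \<open>e\<close> and \<open>f\<close> in \<open>H\<^sup>1\<close>, then \<open>\<phi> \<otimes> \<psi>\<close> approximates \<open>e \<otimes> f\<close> (\<open>H01_tensor\<close>).

  The Dirichlet form is defined through a chosen weak gradient, so all of this rests on weak gradients being unique
  almost everywhere, that is, on test functions being total in \<open>L\<^sup>2\<close>. On each factor the
  eigenfunctions form an orthonormal basis of \<open>L\<^sup>2\<close>, and each of them is an \<open>L\<^sup>2\<close> limit of test functions, since it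
  lies in \<open>H\<^sub>0\<^sup>1\<close> (\<open>test_functions_total_if_H01_basis\<close>). On the product, the functions \<open>e\<^sub>j \<otimes> f\<^sub>k\<close> are total in \<open>L\<^sup>2\<close>
  by applying completeness in one variable after the other, and they are limits of products \<open>\<phi> \<otimes> \<psi>\<close> of test functions
  (\<open>test_functions_total_Times\<close>).
\<close>

section \<open>Lebesgue measure on a product\<close>

lemma null_sets_lborel_vimage_fst:
  assumes N: "(N :: 'a::euclidean_space set) \<in> null_sets lborel"
  shows "fst -` N \<in> null_sets (lborel :: ('a \<times> 'b::euclidean_space) measure)"
proof -
  have "emeasure lborel (N \<times> (UNIV :: 'b set)) = emeasure lborel N * emeasure lborel (UNIV :: 'b set)"
    using N by (subst lborel_prod[symmetric], subst lborel.emeasure_pair_measure_Times) auto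
  then have "N \<times> (UNIV :: 'b set) \<in> null_sets lborel"
    using N by (auto simp: null_sets_def borel_Times)
  moreover have "fst -` N = N \<times> (UNIV :: 'b set)" by auto
  ultimately show ?thesis by simp
qed

lemma null_sets_lborel_vimage_snd:
  assumes N: "(N :: 'b::euclidean_space set) \<in> null_sets lborel"
  shows "snd -` N \<in> null_sets (lborel :: ('a::euclidean_space \<times> 'b) measure)"
proof -
  have "emeasure lborel ((UNIV :: 'a set) \<times> N) = emeasure lborel (UNIV :: 'a set) * emeasure lborel N"
    using N by (subst lborel_prod[symmetric], subst lborel.emeasure_pair_measure_Times) auto
  then have "(UNIV :: 'a set) \<times> N \<in> null_sets lborel"
    using N by (auto simp: null_sets_def borel_Times)
  moreover have "snd -` N = (UNIV :: 'a set) \<times> N" by auto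
  ultimately show ?thesis by simp
qed

lemma AE_lborel_fst:
  assumes "AE x in lborel. P x"
  shows "AE p in (lborel :: ('a::euclidean_space \<times> 'b::euclidean_space) measure). P (fst p)"
proof -
  obtain N where "N \<in> null_sets lborel" "{x. \<not> P x} \<subseteq> N"
    using assms by (auto simp: eventually_ae_filter)
  then show ?thesis
    by (intro AE_I'[OF null_sets_lborel_vimage_fst]) auto
qed

lemma AE_lborel_snd:
  assumes "AE x in lborel. P x"
  shows "AE p in (lborel :: ('a::euclidean_space \<times> 'b::euclidean_space) measure). P (snd p)"
proof -
  obtain N where "N \<in> null_sets lborel" "{x. \<not> P x} \<subseteq> N"
    using assms by (auto simp: eventually_ae_filter)
  then show ?thesis
    by (intro AE_I'[OF null_sets_lborel_vimage_snd]) auto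
qed

text \<open>
  A Lebesgue set is a Borel set up to a null set, and the cylinder over a null set is null; so the cylinder over a Lebesgue
  set is Lebesgue measurable.
\<close>

lemma lebesgue_measurable_fst:
  "fst \<in> (lebesgue :: ('a::euclidean_space \<times> 'b::euclidean_space) measure) \<rightarrow>\<^sub>M lebesgue"
proof -
  have m: "fst \<in> (lebesgue :: ('a \<times> 'b) measure) \<rightarrow>\<^sub>M lborel"
    by (rule measurable_completion) (simp add: borel_prod[symmetric] del: borel_prod)
  show ?thesis
  proof (rule completion.measurable_completion2[OF m], rule subsetI)
    fix N :: "'a set" assume N: "N \<in> null_sets lborel"
    then show "N \<in> null_sets (distr (lebesgue :: ('a \<times> 'b) measure) lborel fst)"
      using null_sets_completionI[OF null_sets_lborel_vimage_fst[OF N, where 'b='b]]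
      by (subst null_sets_distr_iff[OF m]) auto
  qed
qed

lemma lebesgue_measurable_snd:
  "snd \<in> (lebesgue :: ('a::euclidean_space \<times> 'b::euclidean_space) measure) \<rightarrow>\<^sub>M lebesgue"
proof -
  have m: "snd \<in> (lebesgue :: ('a \<times> 'b) measure) \<rightarrow>\<^sub>M lborel"
    by (rule measurable_completion) (simp add: borel_prod[symmetric] del: borel_prod)
  show ?thesis
  proof (rule completion.measurable_completion2[OF m], rule subsetI)
    fix N :: "'b set" assume N: "N \<in> null_sets lborel"
    then show "N \<in> null_sets (distr (lebesgue :: ('a \<times> 'b) measure) lborel snd)"
      using null_sets_completionI[OF null_sets_lborel_vimage_snd[OF N, where 'a='a]]
      by (subst null_sets_distr_iff[OF m]) auto
  qed
qed

lemma lebesgue_Times: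
  assumes "A \<in> sets lebesgue" "B \<in> sets lebesgue"
  shows "(A :: 'a::euclidean_space set) \<times> (B :: 'b::euclidean_space set) \<in> sets lebesgue"
proof -
  have "fst -` A \<inter> space (lebesgue :: ('a \<times> 'b) measure) \<in> sets lebesgue"
    "snd -` B \<inter> space (lebesgue :: ('a \<times> 'b) measure) \<in> sets lebesgue"
    using lebesgue_measurable_fst lebesgue_measurable_snd assms by (blast intro: measurable_sets)+
  then have "(fst -` A) \<inter> (snd -` B) \<in> sets (lebesgue :: ('a \<times> 'b) measure)" by auto
  moreover have "(fst -` A) \<inter> (snd -` B) = A \<times> B" by auto
  ultimately show ?thesis by simp
qed

lemma borel_measurable_lebesgue_on_fst:
  fixes f :: "'a::euclidean_space \<Rightarrow> 'c::euclidean_space"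
  assumes f: "f \<in> borel_measurable (lebesgue_on A)"
  shows "(\<lambda>p. f (fst p)) \<in> borel_measurable (lebesgue_on (A \<times> (B :: 'b::euclidean_space set)))"
proof -
  have "fst \<in> lebesgue_on (A \<times> B) \<rightarrow>\<^sub>M lebesgue_on A"
    by (rule measurable_restrict_space3[OF lebesgue_measurable_fst]) auto
  from measurable_compose[OF this f] show ?thesis .
qed

lemma borel_measurable_lebesgue_on_snd:
  fixes f :: "'b::euclidean_space \<Rightarrow> 'c::euclidean_space"
  assumes f: "f \<in> borel_measurable (lebesgue_on B)"
  shows "(\<lambda>p. f (snd p)) \<in> borel_measurable (lebesgue_on ((A :: 'a::euclidean_space set) \<times> B))"
proof -
  have "snd \<in> lebesgue_on (A \<times> B) \<rightarrow>\<^sub>M lebesgue_on B"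
    by (rule measurable_restrict_space3[OF lebesgue_measurable_snd]) auto
  from measurable_compose[OF this f] show ?thesis .
qed

text \<open>
  Passing to a Borel representative reduces integrals for Lebesgue measure to \<^term>\<open>lborel\<close>, where the product
  structure is available.
\<close>

lemma integrable_lebesgue_obtain_borel:
  fixes f :: "'a::euclidean_space \<Rightarrow> real"
  assumes f: "integrable lebesgue f"
  obtains g where "integrable lborel g" "AE x in lborel. f x = g x"
    "integral\<^sup>L lebesgue f = integral\<^sup>L lborel g"
proof -
  obtain g where g[measurable]: "g \<in> borel_measurable lborel" and ae: "AE x in lborel. f x = g x"
    using completion_ex_borel_measurable_real[OF borel_measurable_integrable[OF f]] by auto
  have ae': "AE x in lebesgue. f x = g x" using ae by (rule AE_completion)
  have gm: "g \<in> borel_measurable lebesgue" using g by (rule measurable_completion)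
  have "integrable lebesgue g"
    using integrable_cong_AE[OF borel_measurable_integrable[OF f] gm ae'] f by simp
  then have "integrable lborel g" by (simp add: integrable_completion)
  moreover have "integral\<^sup>L lebesgue f = integral\<^sup>L lborel g"
    using integral_cong_AE[OF borel_measurable_integrable[OF f] gm ae'] by (simp add: integral_completion)
  ultimately show ?thesis using ae that by blast
qed

lemma lebesgue_integral_AE_eq_lborel:
  fixes f g :: "'a::euclidean_space \<Rightarrow> real"
  assumes g: "integrable lborel g" and ae: "AE x in lborel. f x = g x"
  shows "integrable lebesgue f" "integral\<^sup>L lebesgue f = integral\<^sup>L lborel g"
proof -
  have ae': "AE x in lebesgue. g x = f x" using ae by (intro AE_completion) auto
  have gm: "g \<in> borel_measurable lebesgue"
    using g by (intro measurable_completion) auto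
  then have fm: "f \<in> borel_measurable lebesgue"
    by (rule borel_measurable_AE) (use ae' in auto)
  have "integrable lebesgue g" using g by (subst integrable_completion) auto
  then show "integrable lebesgue f"
    using integrable_cong_AE[OF gm fm ae'] by simp
  show "integral\<^sup>L lebesgue f = integral\<^sup>L lborel g"
    using integral_cong_AE[OF gm fm ae'] g by (simp add: integral_completion)
qed

text \<open>
  Fubini's theorem for the completed measure: a Borel representative \<open>G\<close> of \<open>H\<close> satisfies the usual theorem, and almost every
  slice of \<open>H\<close> agrees almost everywhere with the slice of \<open>G\<close>, hence is measurable for the completed measure.
\<close>

lemma Fubini_lebesgue:
  fixes H :: "'a::euclidean_space \<times> 'b::euclidean_space \<Rightarrow> real"
  assumes H: "integrable lebesgue H"
  shows "AE y in lebesgue. integrable lebesgue (\<lambda>x. H (x, y))"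
    "integrable lebesgue (\<lambda>y. LINT x|lebesgue. H (x, y))"
    "(LINT y|lebesgue. LINT x|lebesgue. H (x, y)) = integral\<^sup>L lebesgue H"
    "AE x in lebesgue. integrable lebesgue (\<lambda>y. H (x, y))"
    "integrable lebesgue (\<lambda>x. LINT y|lebesgue. H (x, y))"
    "(LINT x|lebesgue. LINT y|lebesgue. H (x, y)) = integral\<^sup>L lebesgue H"
proof -
  obtain G where G: "integrable lborel G" and ae: "AE p in lborel. H p = G p"
    and eq: "integral\<^sup>L lebesgue H = integral\<^sup>L lborel G"
    using integrable_lebesgue_obtain_borel[OF H] .
  have G2: "integrable (lborel \<Otimes>\<^sub>M lborel) (case_prod (\<lambda>x y. G (x, y)))"
    using G by (simp add: lborel_prod)
  have ae2: "AE p in lborel \<Otimes>\<^sub>M lborel. H p = G p" using ae unfolding lborel_prod .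
  have aex: "AE x in lborel. AE y in lborel. H (x, y) = G (x, y)"
    by (rule lborel_pair.AE_pair[OF ae2])
  have sw: "AE p in lborel \<Otimes>\<^sub>M lborel. (\<lambda>(y,x). H (x, y) = G (x, y)) p"
    using ae2 by (subst (asm) lborel_pair.distr_pair_swap)
      (auto dest!: AE_distrD[rotated] simp: case_prod_beta measurable_pair_swap')
  have aey: "AE y in lborel. AE x in lborel. H (x, y) = G (x, y)"
    using lborel_pair.AE_pair[OF sw] by simp
  have "AE y in lborel. integrable lebesgue (\<lambda>x. H (x, y)) \<and>
      (LINT x|lebesgue. H (x, y)) = (LINT x|lborel. G (x, y))"
    using lborel_pair.AE_integrable_snd[OF G2] aey
    by eventually_elim (auto intro: lebesgue_integral_AE_eq_lborel)
  then show "AE y in lebesgue. integrable lebesgue (\<lambda>x. H (x, y))"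
    "integrable lebesgue (\<lambda>y. LINT x|lebesgue. H (x, y))"
    "(LINT y|lebesgue. LINT x|lebesgue. H (x, y)) = integral\<^sup>L lebesgue H"
    using lebesgue_integral_AE_eq_lborel[OF lborel_pair.integrable_snd[OF G2], of "\<lambda>y. LINT x|lebesgue. H (x, y)"]
      lborel_pair.integral_snd[OF G2] eq
    by (auto intro!: AE_completion simp: lborel_prod)
  have "AE x in lborel. integrable lebesgue (\<lambda>y. H (x, y)) \<and>
      (LINT y|lebesgue. H (x, y)) = (LINT y|lborel. G (x, y))"
    using lborel_pair.AE_integrable_fst[OF G2] aex
    by eventually_elim (auto intro: lebesgue_integral_AE_eq_lborel)
  then show "AE x in lebesgue. integrable lebesgue (\<lambda>y. H (x, y))"
    "integrable lebesgue (\<lambda>x. LINT y|lebesgue. H (x, y))"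
    "(LINT x|lebesgue. LINT y|lebesgue. H (x, y)) = integral\<^sup>L lebesgue H"
    using lebesgue_integral_AE_eq_lborel[OF lborel_pair.integrable_fst[OF G2], of "\<lambda>x. LINT y|lebesgue. H (x, y)"]
      lborel_pair.integral_fst[OF G2] eq
    by (auto intro!: AE_completion simp: lborel_prod)
qed

lemma Fubini_lebesgue_on:
  fixes H :: "'a::euclidean_space \<times> 'b::euclidean_space \<Rightarrow> real"
  assumes A: "A \<in> sets lebesgue" and B: "B \<in> sets lebesgue"
    and H: "integrable (lebesgue_on (A \<times> B)) H"
  shows "AE y in lebesgue_on B. integrable (lebesgue_on A) (\<lambda>x. H (x, y))"
    "integrable (lebesgue_on B) (\<lambda>y. LINT x|lebesgue_on A. H (x, y))"
    "(LINT y|lebesgue_on B. LINT x|lebesgue_on A. H (x, y)) = integral\<^sup>L (lebesgue_on (A \<times> B)) H"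
    "AE x in lebesgue_on A. integrable (lebesgue_on B) (\<lambda>y. H (x, y))"
    "integrable (lebesgue_on A) (\<lambda>x. LINT y|lebesgue_on B. H (x, y))"
    "(LINT x|lebesgue_on A. LINT y|lebesgue_on B. H (x, y)) = integral\<^sup>L (lebesgue_on (A \<times> B)) H"
proof -
  let ?H = "\<lambda>p. if p \<in> A \<times> B then H p else 0"
  note AB = lebesgue_Times[OF A B]
  have H': "integrable lebesgue ?H"
    using H Lebesgue_Measure.integrable_restrict_UNIV[OF AB, of H] by simp
  have y: "(\<lambda>x. ?H (x, y)) = (if y \<in> B then (\<lambda>x. if x \<in> A then H (x, y) else 0) else (\<lambda>x. 0))" for y
    by auto
  have x: "(\<lambda>y. ?H (x, y)) = (if x \<in> A then (\<lambda>y. if y \<in> B then H (x, y) else 0) else (\<lambda>y. 0))" for x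
    by auto
  have iy: "(LINT x|lebesgue. ?H (x, y)) = (if y \<in> B then LINT x|lebesgue_on A. H (x, y) else 0)" for y
    unfolding y using Lebesgue_Measure.integral_restrict_UNIV[OF A, of "\<lambda>x. H (x, y)"] by simp
  have ix: "(LINT y|lebesgue. ?H (x, y)) = (if x \<in> A then LINT y|lebesgue_on B. H (x, y) else 0)" for x
    unfolding x using Lebesgue_Measure.integral_restrict_UNIV[OF B, of "\<lambda>y. H (x, y)"] by simp
  note F = Fubini_lebesgue[OF H']
  show "AE y in lebesgue_on B. integrable (lebesgue_on A) (\<lambda>x. H (x, y))"
    using F(1) unfolding y by (simp add: AE_restrict_space_iff B)
      (auto elim!: eventually_mono simp: Lebesgue_Measure.integrable_restrict_UNIV A)
  show "integrable (lebesgue_on B) (\<lambda>y. LINT x|lebesgue_on A. H (x, y))"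
    using F(2) unfolding iy by (simp add: Lebesgue_Measure.integrable_restrict_UNIV B)
  show "(LINT y|lebesgue_on B. LINT x|lebesgue_on A. H (x, y)) = integral\<^sup>L (lebesgue_on (A \<times> B)) H"
    using F(3) unfolding iy
    using Lebesgue_Measure.integral_restrict_UNIV[OF B, of "\<lambda>y. LINT x|lebesgue_on A. H (x, y)"]
      Lebesgue_Measure.integral_restrict_UNIV[OF AB, of H] by simp
  show "AE x in lebesgue_on A. integrable (lebesgue_on B) (\<lambda>y. H (x, y))"
    using F(4) unfolding x by (simp add: AE_restrict_space_iff A)
      (auto elim!: eventually_mono simp: Lebesgue_Measure.integrable_restrict_UNIV B)
  show "integrable (lebesgue_on A) (\<lambda>x. LINT y|lebesgue_on B. H (x, y))"
    using F(5) unfolding ix by (simp add: Lebesgue_Measure.integrable_restrict_UNIV A)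
  show "(LINT x|lebesgue_on A. LINT y|lebesgue_on B. H (x, y)) = integral\<^sup>L (lebesgue_on (A \<times> B)) H"
    using F(6) unfolding ix
    using Lebesgue_Measure.integral_restrict_UNIV[OF A, of "\<lambda>x. LINT y|lebesgue_on B. H (x, y)"]
      Lebesgue_Measure.integral_restrict_UNIV[OF AB, of H] by simp
qed

lemma integrable_tensor_lebesgue:
  fixes f :: "'a::euclidean_space \<Rightarrow> real" and g :: "'b::euclidean_space \<Rightarrow> real"
  assumes f: "integrable lebesgue f" and g: "integrable lebesgue g"
  shows "integrable lebesgue (\<lambda>p. f (fst p) * g (snd p))"
proof -
  obtain f' where f': "integrable lborel f'" and aef: "AE x in lborel. f x = f' x"
    using integrable_lebesgue_obtain_borel[OF f] .
  obtain g' where g': "integrable lborel g'" and aeg: "AE x in lborel. g x = g' x"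
    using integrable_lebesgue_obtain_borel[OF g] .
  have [measurable]: "f' \<in> borel_measurable lborel" "g' \<in> borel_measurable lborel"
    using f' g' by auto
  have "integrable (lborel \<Otimes>\<^sub>M lborel) (\<lambda>p. f' (fst p) * g' (snd p))"
  proof (rule lborel_pair.Fubini_integrable)
    show "integrable lborel (\<lambda>x. LINT y|lborel. norm (f' (fst (x, y)) * g' (snd (x, y))))"
      using f' by (simp add: abs_mult)
    show "AE x in lborel. integrable lborel (\<lambda>y. f' (fst (x, y)) * g' (snd (x, y)))"
      using g' by simp
  qed measurable
  then have *: "integrable lborel (\<lambda>p. f' (fst p) * g' (snd p))" by (simp add: lborel_prod)
  have "AE p in lborel. f (fst p) * g (snd p) = f' (fst p) * g' (snd p)"
    using AE_lborel_fst[OF aef, where 'b='b] AE_lborel_snd[OF aeg, where 'a='a]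
    by eventually_elim simp
  from lebesgue_integral_AE_eq_lborel(1)[OF * this] show ?thesis .
qed

lemma integrable_tensor_lebesgue_on:
  fixes f :: "'a::euclidean_space \<Rightarrow> real" and g :: "'b::euclidean_space \<Rightarrow> real"
  assumes A: "A \<in> sets lebesgue" and B: "B \<in> sets lebesgue"
    and f: "integrable (lebesgue_on A) f" and g: "integrable (lebesgue_on B) g"
  shows "integrable (lebesgue_on (A \<times> B)) (\<lambda>p. f (fst p) * g (snd p))"
    "(LINT p|lebesgue_on (A \<times> B). f (fst p) * g (snd p)) =
      (LINT x|lebesgue_on A. f x) * (LINT y|lebesgue_on B. g y)"
proof -
  have "integrable lebesgue (\<lambda>x. if x \<in> A then f x else 0)"
    "integrable lebesgue (\<lambda>y. if y \<in> B then g y else 0)"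
    using f g by (simp_all add: Lebesgue_Measure.integrable_restrict_UNIV A B)
  from integrable_tensor_lebesgue[OF this]
  have "integrable lebesgue (\<lambda>p. if p \<in> A \<times> B then f (fst p) * g (snd p) else 0)"
    by (rule back_subst[of "integrable lebesgue"]) (auto simp: fun_eq_iff)
  then show *: "integrable (lebesgue_on (A \<times> B)) (\<lambda>p. f (fst p) * g (snd p))"
    by (simp add: Lebesgue_Measure.integrable_restrict_UNIV lebesgue_Times A B)
  show "(LINT p|lebesgue_on (A \<times> B). f (fst p) * g (snd p)) =
      (LINT x|lebesgue_on A. f x) * (LINT y|lebesgue_on B. g y)"
    using Fubini_lebesgue_on(3)[OF A B *] by simp
qed

section \<open>The inner product of \<open>L\<^sup>2\<close>\<close>

lemma L2_measurable: "u \<in> L2 \<Omega> \<Longrightarrow> u \<in> borel_measurable (lebesgue_on \<Omega>)"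
  by (simp add: L2_def)

lemma L2_inner_self_integrable: "u \<in> L2 \<Omega> \<Longrightarrow> integrable (lebesgue_on \<Omega>) (\<lambda>x. u x \<bullet> u x)"
  by (simp add: L2_def power2_norm_eq_inner)

lemma L2_inner_integrable:
  assumes u: "u \<in> L2 \<Omega>" and v: "v \<in> L2 \<Omega>"
  shows "integrable (lebesgue_on \<Omega>) (\<lambda>x. u x \<bullet> v x)"
proof (rule Bochner_Integration.integrable_bound)
  show "integrable (lebesgue_on \<Omega>) (\<lambda>x. u x \<bullet> u x + v x \<bullet> v x)"
    using assms by (intro Bochner_Integration.integrable_add L2_inner_self_integrable)
  show "(\<lambda>x. u x \<bullet> v x) \<in> borel_measurable (lebesgue_on \<Omega>)"
    using assms[THEN L2_measurable] by measurable
  have "norm (a \<bullet> b) \<le> norm (a \<bullet> a + b \<bullet> b)" for a b :: 'b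
  proof -
    have "\<bar>a \<bullet> b\<bar> \<le> norm a * norm b" by (rule Cauchy_Schwarz_ineq2)
    also have "\<dots> \<le> norm a ^ 2 + norm b ^ 2"
      using sum_squares_bound[of "norm a" "norm b"] mult_nonneg_nonneg[OF norm_ge_zero norm_ge_zero, of a b]
      by linarith
    finally show ?thesis by (simp add: power2_norm_eq_inner)
  qed
  then show "AE x in lebesgue_on \<Omega>. norm (u x \<bullet> v x) \<le> norm (u x \<bullet> u x + v x \<bullet> v x)" by blast
qed

lemma L2_add:
  assumes u: "u \<in> L2 \<Omega>" and v: "v \<in> L2 \<Omega>"
  shows "(\<lambda>x. u x + v x) \<in> L2 \<Omega>"
proof -
  have "integrable (lebesgue_on \<Omega>) (\<lambda>x. u x \<bullet> u x + 2 * (u x \<bullet> v x) + v x \<bullet> v x)"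
    using assms by (intro Bochner_Integration.integrable_add integrable_mult_right L2_inner_integrable)
  moreover have "u x \<bullet> u x + 2 * (u x \<bullet> v x) + v x \<bullet> v x = (norm (u x + v x))\<^sup>2" for x
    by (simp add: power2_norm_eq_inner inner_add_left inner_add_right inner_commute)
  ultimately show ?thesis
    using assms[THEN L2_measurable] by (simp add: L2_def)
qed

lemma L2_scaleR: "u \<in> L2 \<Omega> \<Longrightarrow> (\<lambda>x. c *\<^sub>R u x) \<in> L2 \<Omega>"
  unfolding L2_def by (auto simp: power_mult_distrib intro!: borel_measurable_scaleR)

lemma L2_diff:
  assumes "u \<in> L2 \<Omega>" and "v \<in> L2 \<Omega>"
  shows "(\<lambda>x. u x - v x) \<in> L2 \<Omega>"
  using L2_add[OF assms(1) L2_scaleR[OF assms(2), of "-1"]] by simp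

lemma L2_component:
  assumes "g \<in> L2 \<Omega>"
  shows "(\<lambda>x. g x \<bullet> b) \<in> L2 \<Omega>"
proof -
  have m: "(\<lambda>x. g x \<bullet> b) \<in> borel_measurable (lebesgue_on \<Omega>)"
    using assms[THEN L2_measurable] by measurable
  have "integrable (lebesgue_on \<Omega>) (\<lambda>x. (norm (g x))\<^sup>2 * (norm b)\<^sup>2)"
    using assms by (intro integrable_mult_left) (simp add: L2_def)
  then have "integrable (lebesgue_on \<Omega>) (\<lambda>x. (norm (g x \<bullet> b))\<^sup>2)"
  proof (rule Bochner_Integration.integrable_bound)
    have "(norm (g x \<bullet> b))\<^sup>2 \<le> (norm (g x))\<^sup>2 * (norm b)\<^sup>2" for x
      using power_mono[OF Cauchy_Schwarz_ineq2[of "g x" b], of 2] by (simp add: power_mult_distrib)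
    then show "AE x in lebesgue_on \<Omega>. norm ((norm (g x \<bullet> b))\<^sup>2) \<le> norm ((norm (g x))\<^sup>2 * (norm b)\<^sup>2)"
      by (simp add: abs_mult)
  qed (use m in measurable)
  with m show ?thesis by (simp add: L2_def)
qed

lemma L2_inner_commute: "L2_inner \<Omega> u v = L2_inner \<Omega> v u"
  by (simp add: L2_inner_def inner_commute)

lemma L2_inner_diff_left:
  assumes "u \<in> L2 \<Omega>" "v \<in> L2 \<Omega>" "w \<in> L2 \<Omega>"
  shows "L2_inner \<Omega> (\<lambda>x. u x - v x) w = L2_inner \<Omega> u w - L2_inner \<Omega> v w"
  using assms by (simp add: L2_inner_def inner_diff_left L2_inner_integrable)

lemma L2_inner_diff_right:
  assumes "u \<in> L2 \<Omega>" "v \<in> L2 \<Omega>" "w \<in> L2 \<Omega>"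
  shows "L2_inner \<Omega> w (\<lambda>x. u x - v x) = L2_inner \<Omega> w u - L2_inner \<Omega> w v"
  using assms by (simp add: L2_inner_def inner_diff_right L2_inner_integrable)

lemma L2_inner_scaleR_left: "L2_inner \<Omega> (\<lambda>x. c *\<^sub>R u x) w = c * L2_inner \<Omega> u w"
  by (simp add: L2_inner_def)

lemma L2_inner_self_nonneg: "0 \<le> L2_inner \<Omega> u u"
  by (simp add: L2_inner_def)

lemma L2_inner_self_eq_0:
  assumes u: "u \<in> L2 \<Omega>" and "L2_inner \<Omega> u u = 0"
  shows "AE x in lebesgue_on \<Omega>. u x = 0"
  using integral_nonneg_eq_0_iff_AE[OF L2_inner_self_integrable[OF u]] assms(2)
  by (simp add: L2_inner_def)

lemma L2_inner_cong_AE: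
  assumes "u \<in> L2 \<Omega>" "u' \<in> L2 \<Omega>" "v \<in> L2 \<Omega>" "v' \<in> L2 \<Omega>"
    and "AE x in lebesgue_on \<Omega>. u x = u' x" "AE x in lebesgue_on \<Omega>. v x = v' x"
  shows "L2_inner \<Omega> u v = L2_inner \<Omega> u' v'"
  unfolding L2_inner_def
proof (rule integral_cong_AE)
  show "AE x in lebesgue_on \<Omega>. u x \<bullet> v x = u' x \<bullet> v' x"
    using assms(5,6) by eventually_elim simp
qed (use assms(1-4)[THEN L2_measurable] in measurable)

text \<open>
  The discriminant argument for the quadratic \<open>t \<mapsto> L2_inner \<Omega> (u - t v) (u - t v)\<close>. As \<^const>\<open>L2_inner\<close> is only
  semidefinite on functions, its leading coefficient may vanish for a nonzero \<open>v\<close>; the quadratic is then affine and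
  bounded below, hence constant.
\<close>

lemma L2_inner_Cauchy_Schwarz:
  assumes u: "u \<in> L2 \<Omega>" and v: "v \<in> L2 \<Omega>"
  shows "(L2_inner \<Omega> u v)\<^sup>2 \<le> L2_inner \<Omega> u u * L2_inner \<Omega> v v"
proof -
  define a b c where "a = L2_inner \<Omega> u u" and "b = L2_inner \<Omega> u v" and "c = L2_inner \<Omega> v v"
  have q: "0 \<le> a - 2 * t * b + t\<^sup>2 * c" for t
  proof -
    let ?w = "\<lambda>x. u x - t *\<^sub>R v x"
    note tv = L2_scaleR[OF v, of t]
    have "L2_inner \<Omega> ?w ?w = a - 2 * t * b + t\<^sup>2 * c"
      using u v tv L2_diff[OF u tv]
      by (simp add: L2_inner_diff_left L2_inner_diff_right L2_inner_scaleR_left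
          L2_inner_commute[of \<Omega> _ "\<lambda>x. t *\<^sub>R v x"] L2_inner_commute[of \<Omega> v u]
          a_def b_def c_def power2_eq_square algebra_simps)
    then show ?thesis using L2_inner_self_nonneg[of \<Omega> ?w] by simp
  qed
  have c: "0 \<le> c" unfolding c_def by (rule L2_inner_self_nonneg)
  show ?thesis
  proof (cases "c = 0")
    case True
    have "b = 0"
    proof (rule ccontr)
      assume "b \<noteq> 0"
      \<comment> \<open>With \<open>c = 0\<close> the quadratic is affine in \<open>t\<close>; at this \<open>t\<close> it takes the value \<open>-1\<close>.\<close>
      then show False using q[of "(a + 1) / (2 * b)"] True by (simp add: field_simps)
    qed
    then show ?thesis using True by (simp add: b_def c_def)
  next
    case False
    \<comment> \<open>The quadratic attains its minimum at \<open>t = b / c\<close>.\<close>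
    then have "b\<^sup>2 \<le> a * c" using q[of "b / c"] c
      by (simp add: power2_eq_square field_simps)
    then show ?thesis by (simp add: a_def b_def c_def)
  qed
qed

lemma L2_tensor:
  fixes f :: "'a::euclidean_space \<Rightarrow> real" and g :: "'b::euclidean_space \<Rightarrow> real"
  assumes A: "A \<in> sets lebesgue" and B: "B \<in> sets lebesgue"
    and f: "f \<in> L2 A" and g: "g \<in> L2 B"
  shows "tensor f g \<in> L2 (A \<times> B)"
    "L2_inner (A \<times> B) (tensor f g) (tensor f g) = L2_inner A f f * L2_inner B g g"
proof -
  have t: "tensor f g = (\<lambda>p. f (fst p) * g (snd p))" by (auto simp: tensor_def)
  have eq: "(f x * g y)\<^sup>2 = (f x * f x) * (g y * g y)" for x y by (simp add: power2_eq_square)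
  have "integrable (lebesgue_on A) (\<lambda>x. f x * f x)" "integrable (lebesgue_on B) (\<lambda>x. g x * g x)"
    using f g by (auto dest!: L2_inner_self_integrable)
  note i = integrable_tensor_lebesgue_on[OF A B this]
  show "tensor f g \<in> L2 (A \<times> B)"
    using i(1) borel_measurable_lebesgue_on_fst[OF L2_measurable[OF f], of B]
      borel_measurable_lebesgue_on_snd[OF L2_measurable[OF g], of A]
    by (auto simp: L2_def t eq)
  show "L2_inner (A \<times> B) (tensor f g) (tensor f g) = L2_inner A f f * L2_inner B g g"
    using i(2) by (simp add: L2_inner_def t mult_ac)
qed

text \<open>
  The gradient of \<open>e \<otimes> f\<close> according to the product rule, when \<open>g1\<close> and \<open>g2\<close> are gradients of \<open>e\<close> and \<open>f\<close>.
\<close>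

definition tensor_gradient ::
    "('a \<Rightarrow> real) \<Rightarrow> ('b \<Rightarrow> real) \<Rightarrow> ('a \<Rightarrow> 'a::euclidean_space) \<Rightarrow> ('b \<Rightarrow> 'b::euclidean_space) \<Rightarrow>
      'a \<times> 'b \<Rightarrow> 'a \<times> 'b" where
  "tensor_gradient e f g1 g2 = (\<lambda>(x, y). (f y *\<^sub>R g1 x, e x *\<^sub>R g2 y))"

lemma L2_tensor_gradient:
  fixes f :: "'a::euclidean_space \<Rightarrow> real" and g :: "'b::euclidean_space \<Rightarrow> real"
  assumes A: "A \<in> sets lebesgue" and B: "B \<in> sets lebesgue"
    and f: "f \<in> L2 A" and g: "g \<in> L2 B" and F: "F \<in> L2 A" and G: "G \<in> L2 B"
  shows "tensor_gradient f g F G \<in> L2 (A \<times> B)"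
    "L2_inner (A \<times> B) (tensor_gradient f g F G) (tensor_gradient f g F G) =
      L2_inner A F F * L2_inner B g g + L2_inner A f f * L2_inner B G G"
proof -
  note i1 = integrable_tensor_lebesgue_on[OF A B L2_inner_self_integrable[OF F] L2_inner_self_integrable[OF g]]
  note i2 = integrable_tensor_lebesgue_on[OF A B L2_inner_self_integrable[OF f] L2_inner_self_integrable[OF G]]
  let ?h = "tensor_gradient f g F G"
  have h: "?h = (\<lambda>p. (g (snd p) *\<^sub>R F (fst p), f (fst p) *\<^sub>R G (snd p)))"
    by (auto simp: tensor_gradient_def)
  have eq: "?h p \<bullet> ?h p = F (fst p) \<bullet> F (fst p) * (g (snd p) \<bullet> g (snd p)) +
      f (fst p) \<bullet> f (fst p) * (G (snd p) \<bullet> G (snd p))" for p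
    by (simp add: h inner_Pair mult_ac)
  show "?h \<in> L2 (A \<times> B)"
    using i1(1) i2(1)
      borel_measurable_lebesgue_on_fst[OF L2_measurable[OF f], of B]
      borel_measurable_lebesgue_on_fst[OF L2_measurable[OF F], of B]
      borel_measurable_lebesgue_on_snd[OF L2_measurable[OF g], of A]
      borel_measurable_lebesgue_on_snd[OF L2_measurable[OF G], of A]
    unfolding L2_def power2_norm_eq_inner eq
    by (auto intro!: borel_measurable_Pair Bochner_Integration.integrable_add simp: h mult_ac)
  show "L2_inner (A \<times> B) ?h ?h = L2_inner A F F * L2_inner B g g + L2_inner A f f * L2_inner B G G"
    unfolding L2_inner_def eq using i1 i2 by simp
qed

section \<open>Test functions and their gradients\<close>

definition classical_gradient :: "('a::euclidean_space \<Rightarrow> real) \<Rightarrow> 'a \<Rightarrow> 'a" where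
  "classical_gradient \<phi> x = (\<Sum>b\<in>Basis. frechet_derivative \<phi> (at x) b *\<^sub>R b)"

lemma classical_gradient_inner_Basis:
  "b \<in> Basis \<Longrightarrow> classical_gradient \<phi> x \<bullet> b = frechet_derivative \<phi> (at x) b"
  by (simp add: classical_gradient_def inner_sum_left_Basis)

lemma test_functionsD:
  assumes "\<phi> \<in> test_functions \<Omega>"
  shows test_functions_continuous: "continuous_on UNIV \<phi>"
    and test_functions_differentiable: "\<phi> differentiable at x"
    and test_functions_has_derivative: "(\<phi> has_derivative frechet_derivative \<phi> (at x)) (at x)"
    and test_functions_continuous_derivative:
      "b \<in> Basis \<Longrightarrow> continuous_on UNIV (\<lambda>x. frechet_derivative \<phi> (at x) b)"
    and test_functions_compact: "compact (closure {x. \<phi> x \<noteq> 0})"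
    and test_functions_support: "closure {x. \<phi> x \<noteq> 0} \<subseteq> \<Omega>"
    and test_functions_eq_0: "x \<notin> closure {x. \<phi> x \<noteq> 0} \<Longrightarrow> \<phi> x = 0"
    and test_functions_outside: "x \<notin> \<Omega> \<Longrightarrow> \<phi> x = 0"
proof -
  have C: "C_k k \<phi>" for k using assms by (simp add: test_functions_def)
  show "continuous_on UNIV \<phi>" using C[of 0] by simp
  show d: "\<phi> differentiable at x" using C[of 1] by (simp add: differentiable_on_def)
  show "(\<phi> has_derivative frechet_derivative \<phi> (at x)) (at x)"
    using d by (simp add: frechet_derivative_works)
  show "b \<in> Basis \<Longrightarrow> continuous_on UNIV (\<lambda>x. frechet_derivative \<phi> (at x) b)"
    using C[of 1] by simp
  show "compact (closure {x. \<phi> x \<noteq> 0})" "closure {x. \<phi> x \<noteq> 0} \<subseteq> \<Omega>"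
    using assms by (simp_all add: test_functions_def)
  show "x \<notin> closure {x. \<phi> x \<noteq> 0} \<Longrightarrow> \<phi> x = 0"
    using closure_subset[of "{x. \<phi> x \<noteq> 0}"] by auto
  show "x \<notin> \<Omega> \<Longrightarrow> \<phi> x = 0"
    using assms closure_subset[of "{x. \<phi> x \<noteq> 0}"] by (auto simp: test_functions_def)
qed

lemma has_derivative_outside_support:
  fixes \<phi> :: "'a::euclidean_space \<Rightarrow> real"
  assumes "(\<phi> has_derivative D) (at x)" "closed K" "\<And>x. x \<notin> K \<Longrightarrow> \<phi> x = 0" "x \<notin> K"
  shows "D = (\<lambda>_. 0)"
proof -
  have "(\<phi> has_derivative (\<lambda>_. 0)) (at x)"
    by (rule has_derivative_transform_within_open[of "\<lambda>_. 0" _ _ _ "- K"])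
      (use assms in \<open>auto simp: open_Compl\<close>)
  with assms(1) show ?thesis by (rule has_derivative_unique)
qed

lemma L2_continuous_compact_support:
  fixes f :: "'a::euclidean_space \<Rightarrow> 'b::euclidean_space"
  assumes \<Omega>: "\<Omega> \<in> sets lebesgue" and f: "continuous_on UNIV f"
    and K: "compact K" and 0: "\<And>x. x \<notin> K \<Longrightarrow> f x = 0"
  shows "f \<in> L2 \<Omega>"
proof -
  have fm: "f \<in> borel_measurable borel" using f by (rule borel_measurable_continuous_onI)
  then have "f \<in> borel_measurable (lebesgue_on \<Omega>)"
    by (intro measurable_restrict_space1 measurable_completion) simp
  moreover have "integrable (lebesgue_on \<Omega>) (\<lambda>x. (norm (f x))\<^sup>2)"
  proof -
    have "continuous_on K (\<lambda>x. (norm (f x))\<^sup>2)"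
      by (intro continuous_intros continuous_on_subset[OF f]) auto
    then have "integrable lborel (\<lambda>x. indicator K x *\<^sub>R (norm (f x))\<^sup>2)"
      by (rule borel_integrable_compact[OF K])
    moreover have eq: "indicator K x *\<^sub>R (norm (f x))\<^sup>2 = (norm (f x))\<^sup>2" for x
      using 0[of x] by (auto simp: indicator_def)
    ultimately have "integrable lborel (\<lambda>x. (norm (f x))\<^sup>2)" by (simp only: eq)
    then have "integrable lebesgue (\<lambda>x. (norm (f x))\<^sup>2)"
      using fm by (subst integrable_completion) measurable
    then show ?thesis
      by (rule integrable_restrict_space[THEN iffD2, OF _ integrable_mult_indicator, rotated 2])
        (use \<Omega> in auto)
  qed
  ultimately show ?thesis by (simp add: L2_def)
qed

lemma test_functions_L2:
  assumes "\<Omega> \<in> sets lebesgue" "\<phi> \<in> test_functions \<Omega>"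
  shows "\<phi> \<in> L2 \<Omega>"
  by (rule L2_continuous_compact_support[OF assms(1) test_functions_continuous[OF assms(2)]
        test_functions_compact[OF assms(2)] test_functions_eq_0[OF assms(2)]])

lemma classical_gradient_L2:
  assumes "\<Omega> \<in> sets lebesgue" "\<phi> \<in> test_functions \<Omega>"
  shows "classical_gradient \<phi> \<in> L2 \<Omega>"
proof (rule L2_continuous_compact_support[OF assms(1)])
  note T = test_functionsD[OF assms(2)]
  show "continuous_on UNIV (classical_gradient \<phi>)"
    unfolding classical_gradient_def by (intro continuous_intros T)
  show "compact (closure {x. \<phi> x \<noteq> 0})" by (rule T)
  fix x assume "x \<notin> closure {x. \<phi> x \<noteq> 0}"
  then have "frechet_derivative \<phi> (at x) = (\<lambda>_. 0)"
    by (intro has_derivative_outside_support[OF T(3) closed_closure]) (auto intro: T)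
  then show "classical_gradient \<phi> x = 0" by (simp add: classical_gradient_def)
qed

lemma DERIV_along_line:
  fixes \<phi> :: "'a::euclidean_space \<Rightarrow> real"
  assumes d: "(\<phi> has_derivative D) (at (t *\<^sub>R b + x))"
  shows "((\<lambda>t. \<phi> (t *\<^sub>R b + x)) has_real_derivative D b) (at t)"
proof -
  have "((\<lambda>t. \<phi> (t *\<^sub>R b + x)) has_derivative (\<lambda>s. D (s *\<^sub>R b))) (at t)"
    by (rule has_derivative_compose[of "\<lambda>t. t *\<^sub>R b + x" "\<lambda>s. s *\<^sub>R b" t UNIV \<phi>, OF _ d]) (auto intro!: derivative_eq_intros)
  moreover have "D (s *\<^sub>R b) = D b * s" for s
    using linear_scale[OF has_derivative_linear[OF d]] by simp
  ultimately show ?thesis unfolding has_field_derivative_def by simp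
qed

text \<open>
  By translation invariance the difference quotients of \<open>\<phi>\<close> in direction \<open>b\<close> all have integral \<open>0\<close>. They converge pointwise to
  the derivative, and by the mean value theorem they are dominated by a multiple of the indicator function of a compact
  set containing \<open>K\<close>.
\<close>

lemma integral_directional_derivative_eq_0:
  fixes \<phi> :: "'a::euclidean_space \<Rightarrow> real"
  assumes d: "\<And>x. (\<phi> has_derivative D x) (at x)" and c: "continuous_on UNIV (\<lambda>x. D x b)"
    and K: "compact K" and 0: "\<And>x. x \<notin> K \<Longrightarrow> \<phi> x = 0"
  shows "(LINT x|lborel. D x b) = 0"
proof -
  let ?h = "\<lambda>n. inverse (real (Suc n))"
  define q where "q n x = (\<phi> (?h n *\<^sub>R b + x) - \<phi> x) / ?h n" for n x
  have cont: "continuous_on UNIV \<phi>"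
    using d by (intro continuous_at_imp_continuous_on ballI has_derivative_continuous) blast
  have D0: "D x = (\<lambda>_. 0)" if "x \<notin> K" for x
    using has_derivative_outside_support[OF d compact_imp_closed[OF K] 0 that] .
  have \<phi>int: "integrable lborel \<phi>"
  proof -
    have "integrable lborel (\<lambda>x. indicator K x *\<^sub>R \<phi> x)"
      by (intro borel_integrable_compact[OF K] continuous_on_subset[OF cont]) auto
    moreover have eq: "indicator K x *\<^sub>R \<phi> x = \<phi> x" for x using 0[of x] by (auto simp: indicator_def)
    ultimately show ?thesis by (simp only: eq)
  qed
  have "compact ((\<lambda>x. D x b) ` K)"
    by (intro compact_continuous_image continuous_on_subset[OF c] K) auto
  then obtain M where M: "\<And>x. x \<in> K \<Longrightarrow> \<bar>D x b\<bar> \<le> M"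
    using compact_imp_bounded by (fastforce simp: bounded_iff)
  have M': "\<bar>D x b\<bar> \<le> max M 0" for x
    using M[of x] D0[of x] by (cases "x \<in> K") auto
  \<comment> \<open>The quotients use translations of length at most \<open>norm b\<close>, so all of them vanish outside \<open>K + cball 0 (norm b)\<close>.\<close>
  define K' where "K' = {x + y | x y. x \<in> K \<and> y \<in> cball 0 (norm b)}"
  have K': "compact K'" unfolding K'_def by (rule compact_sums[OF K compact_cball])
  have q0: "(LINT x|lborel. q n x) = 0" for n
  proof -
    have 1: "(LINT x|lborel. \<phi> (?h n *\<^sub>R b + x)) = integral\<^sup>L (distr lborel borel ((+) (?h n *\<^sub>R b))) \<phi>"
      by (rule integral_distr[symmetric]) (use cont borel_measurable_continuous_onI in auto)
    have 2: "integrable lborel (\<lambda>x. \<phi> (?h n *\<^sub>R b + x))"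
      using \<phi>int by (subst (asm) lborel_distr_plus[symmetric, of "?h n *\<^sub>R b"])
        (subst (asm) integrable_distr_eq, use cont borel_measurable_continuous_onI in auto)
    show ?thesis
      unfolding q_def using 1 2 \<phi>int by (simp add: lborel_distr_plus)
  qed
  have bound: "norm (q n x) \<le> max M 0 * indicator K' x" for n x
  proof (cases "x \<in> K'")
    case True
    define g where "g t = \<phi> (t *\<^sub>R b + x)" for t
    have g': "DERIV g t :> D (t *\<^sub>R b + x) b" for t
      unfolding g_def by (rule DERIV_along_line[OF d])
    obtain t where t: "g (?h n) - g 0 = (?h n - 0) * D (t *\<^sub>R b + x) b"
      using MVT2[of 0 "?h n" g "\<lambda>t. D (t *\<^sub>R b + x) b"] g' by auto
    have "q n x = D (t *\<^sub>R b + x) b"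
      using t by (simp add: q_def g_def field_simps)
    with M' True show ?thesis by simp
  next
    case False
    have "x \<notin> K"
    proof
      assume "x \<in> K"
      then have "x + 0 \<in> K'" unfolding K'_def by force
      with False show False by simp
    qed
    moreover have "?h n *\<^sub>R b + x \<notin> K"
    proof
      assume *: "?h n *\<^sub>R b + x \<in> K"
      have "norm (- (?h n *\<^sub>R b)) \<le> norm b"
        using mult_right_mono[of "?h n" 1 "norm b"] by (simp add: inverse_le_1_iff)
      then have "- (?h n *\<^sub>R b) \<in> cball 0 (norm b)" by (simp only: mem_cball_0)
      with * have "(?h n *\<^sub>R b + x) + (- (?h n *\<^sub>R b)) \<in> K'" unfolding K'_def by blast
      with False show False by simp
    qed
    ultimately show ?thesis using 0 False by (simp add: q_def)
  qed
  have "(\<lambda>n. LINT x|lborel. q n x) \<longlonglongrightarrow> (LINT x|lborel. D x b)"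
  proof (rule integral_dominated_convergence)
    show "(\<lambda>x. D x b) \<in> borel_measurable lborel"
      using borel_measurable_continuous_onI[OF c] by simp
    show "q n \<in> borel_measurable lborel" for n
    proof -
      have "continuous_on UNIV (q n)" unfolding q_def
        by (intro continuous_intros continuous_on_compose2[OF cont]) auto
      then show ?thesis using borel_measurable_continuous_onI by simp
    qed
    have "integrable lborel (\<lambda>x. indicator K' x *\<^sub>R max M 0)"
      by (rule borel_integrable_compact[OF K']) simp
    then show "integrable lborel (\<lambda>x. max M 0 * indicator K' x :: real)" by (simp add: mult.commute)
    show "AE x in lborel. norm (q n x) \<le> max M 0 * indicator K' x" for n using bound by blast
    have "(\<lambda>n. q n x) \<longlonglongrightarrow> D x b" for x
    proof -
      have "DERIV (\<lambda>t. \<phi> (t *\<^sub>R b + x)) 0 :> D (0 *\<^sub>R b + x) b"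
        by (rule DERIV_along_line[OF d])
      then have "((\<lambda>h. (\<phi> (h *\<^sub>R b + x) - \<phi> x) / h) \<longlongrightarrow> D x b) (at 0)"
        by (simp add: DERIV_def)
      moreover have "filterlim ?h (at 0) sequentially"
        using LIMSEQ_inverse_real_of_nat by (auto simp: filterlim_at)
      ultimately show ?thesis unfolding q_def by (rule filterlim_compose)
    qed
    then show "AE x in lborel. (\<lambda>n. q n x) \<longlonglongrightarrow> D x b" by blast
  qed
  then show ?thesis by (simp add: q0 LIMSEQ_const_iff)
qed

lemma integral_lebesgue_on_eq_lborel:
  fixes f :: "'a::euclidean_space \<Rightarrow> real"
  assumes \<Omega>: "\<Omega> \<in> sets lebesgue" and f: "continuous_on UNIV f"
    and 0: "\<And>x. x \<notin> \<Omega> \<Longrightarrow> f x = 0"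
  shows "(LINT x|lebesgue_on \<Omega>. f x) = (LINT x|lborel. f x)"
proof -
  have "(LINT x|lebesgue_on \<Omega>. f x) = (LINT x|lebesgue. (if x \<in> \<Omega> then f x else 0))"
    using Lebesgue_Measure.integral_restrict_UNIV[OF \<Omega>, of f] by simp
  also have "(\<lambda>x. if x \<in> \<Omega> then f x else 0) = f" using 0 by auto
  also have "integral\<^sup>L lebesgue f = (LINT x|lborel. f x)"
    by (rule integral_completion) (use borel_measurable_continuous_onI[OF f] in simp)
  finally show ?thesis .
qed

text \<open>
  Integration by parts: the directional derivative of the product of the two functions has integral \<open>0\<close>.
\<close>

lemma test_functions_has_weak_gradient:
  assumes \<Omega>: "\<Omega> \<in> sets lebesgue" and u: "u \<in> test_functions \<Omega>"
  shows "has_weak_gradient \<Omega> u (classical_gradient u)"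
  unfolding has_weak_gradient_def
proof (intro conjI ballI)
  show "u \<in> L2 \<Omega>" "classical_gradient u \<in> L2 \<Omega>"
    using test_functions_L2[OF assms] classical_gradient_L2[OF assms] .
  fix \<phi> :: "'a \<Rightarrow> real" and b :: 'a assume \<phi>: "\<phi> \<in> test_functions \<Omega>" and b: "b \<in> Basis"
  note U = test_functionsD[OF u] and P = test_functionsD[OF \<phi>]
  let ?D = "\<lambda>x h. u x * frechet_derivative \<phi> (at x) h + frechet_derivative u (at x) h * \<phi> x"
  have c: "continuous_on UNIV (\<lambda>x. ?D x b)"
    by (intro continuous_intros U P b)
  have "(LINT x|lborel. ?D x b) = 0"
  proof (rule integral_directional_derivative_eq_0[where K = "closure {x. u x \<noteq> 0}"
        and D = ?D and b = b, OF _ c])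
    show "((\<lambda>x. u x * \<phi> x) has_derivative ?D x) (at x)" for x
      by (rule has_derivative_mult[OF U(3) P(3)])
  qed (rule U(5), drule U(7), simp)
  moreover have "(LINT x|lebesgue_on \<Omega>. ?D x b) = (LINT x|lborel. ?D x b)"
    by (rule integral_lebesgue_on_eq_lborel[OF \<Omega> c]) (simp add: U(8) P(8))
  moreover have "integrable (lebesgue_on \<Omega>) (\<lambda>x. u x * frechet_derivative \<phi> (at x) b)"
    "integrable (lebesgue_on \<Omega>) (\<lambda>x. frechet_derivative u (at x) b * \<phi> x)"
    using L2_inner_integrable[OF test_functions_L2[OF assms] L2_component[OF classical_gradient_L2[OF \<Omega> \<phi>], of b]]
      L2_inner_integrable[OF L2_component[OF classical_gradient_L2[OF assms], of b] test_functions_L2[OF \<Omega> \<phi>]] b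
    by (simp_all add: classical_gradient_inner_Basis)
  ultimately show "(LINT x|lebesgue_on \<Omega>. u x * frechet_derivative \<phi> (at x) b) =
      - (LINT x|lebesgue_on \<Omega>. (classical_gradient u x \<bullet> b) * \<phi> x)"
    using b by (simp add: classical_gradient_inner_Basis)
qed

lemma has_derivative_slice_fst:
  assumes "(\<Phi> has_derivative D) (at (x, y))"
  shows "((\<lambda>x. \<Phi> (x, y)) has_derivative (\<lambda>h. D (h, 0))) (at x)"
  by (rule has_derivative_compose[where f = "\<lambda>x. (x, y)" and f' = "\<lambda>h. (h, 0)" and g' = D, OF _ assms])
    (intro has_derivative_Pair has_derivative_ident has_derivative_const)

lemma has_derivative_slice_snd:
  assumes "(\<Phi> has_derivative D) (at (x, y))"
  shows "((\<lambda>y. \<Phi> (x, y)) has_derivative (\<lambda>h. D (0, h))) (at y)"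
  by (rule has_derivative_compose[where f = "\<lambda>y. (x, y)" and f' = "\<lambda>h. (0, h)" and g' = D, OF _ assms])
    (intro has_derivative_Pair has_derivative_ident has_derivative_const)

lemma frechet_derivative_slice:
  assumes "\<Phi> differentiable at (x, y)"
  shows frechet_derivative_slice_fst:
      "frechet_derivative (\<lambda>x. \<Phi> (x, y)) (at x) = (\<lambda>h. frechet_derivative \<Phi> (at (x, y)) (h, 0))"
    and frechet_derivative_slice_snd:
      "frechet_derivative (\<lambda>y. \<Phi> (x, y)) (at y) = (\<lambda>h. frechet_derivative \<Phi> (at (x, y)) (0, h))"
proof -
  have D: "(\<Phi> has_derivative frechet_derivative \<Phi> (at (x, y))) (at (x, y))"
    using assms unfolding frechet_derivative_works .
  show "frechet_derivative (\<lambda>x. \<Phi> (x, y)) (at x) = (\<lambda>h. frechet_derivative \<Phi> (at (x, y)) (h, 0))"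
    by (rule frechet_derivative_at[OF has_derivative_slice_fst[OF D], symmetric])
  show "frechet_derivative (\<lambda>y. \<Phi> (x, y)) (at y) = (\<lambda>h. frechet_derivative \<Phi> (at (x, y)) (0, h))"
    by (rule frechet_derivative_at[OF has_derivative_slice_snd[OF D], symmetric])
qed

lemma C_k_slice_fst:
  fixes \<Phi> :: "'a::euclidean_space \<times> 'b::euclidean_space \<Rightarrow> real"
  shows "C_k k \<Phi> \<Longrightarrow> C_k k (\<lambda>x. \<Phi> (x, y))"
proof (induction k arbitrary: \<Phi>)
  case 0
  then show ?case
    using continuous_on_compose2[of UNIV \<Phi> UNIV "\<lambda>x. (x, y)"] by (simp add: continuous_on_Pair)
next
  case (Suc k)
  have d: "\<Phi> differentiable at p" for p using Suc.prems by (cases p) (simp add: differentiable_on_def)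
  have "(\<lambda>x. \<Phi> (x, y)) differentiable at x" for x
    by (rule differentiableI[OF has_derivative_slice_fst[OF d[unfolded frechet_derivative_works]]])
  moreover have "C_k k (\<lambda>x. frechet_derivative (\<lambda>x. \<Phi> (x, y)) (at x) b)" if "b \<in> Basis" for b
  proof -
    have "(b, 0) \<in> Basis" using that by (auto simp: Basis_prod_def)
    then have "C_k k (\<lambda>p. frechet_derivative \<Phi> (at p) (b, 0))"
      using Suc.prems unfolding C_k.simps by blast
    from Suc.IH[OF this] show ?thesis by (simp only: frechet_derivative_slice_fst[OF d])
  qed
  ultimately show ?case by (simp add: differentiable_on_def)
qed

lemma C_k_slice_snd:
  fixes \<Phi> :: "'a::euclidean_space \<times> 'b::euclidean_space \<Rightarrow> real"
  shows "C_k k \<Phi> \<Longrightarrow> C_k k (\<lambda>y. \<Phi> (x, y))"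
proof (induction k arbitrary: \<Phi>)
  case 0
  then show ?case
    using continuous_on_compose2[of UNIV \<Phi> UNIV "\<lambda>y. (x, y)"] by (simp add: continuous_on_Pair)
next
  case (Suc k)
  have d: "\<Phi> differentiable at p" for p using Suc.prems by (cases p) (simp add: differentiable_on_def)
  have "(\<lambda>y. \<Phi> (x, y)) differentiable at y" for y
    by (rule differentiableI[OF has_derivative_slice_snd[OF d[unfolded frechet_derivative_works]]])
  moreover have "C_k k (\<lambda>y. frechet_derivative (\<lambda>y. \<Phi> (x, y)) (at y) b)" if "b \<in> Basis" for b
  proof -
    have "(0, b) \<in> Basis" using that by (auto simp: Basis_prod_def)
    then have "C_k k (\<lambda>p. frechet_derivative \<Phi> (at p) (0, b))"
      using Suc.prems unfolding C_k.simps by blast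
    from Suc.IH[OF this] show ?thesis by (simp only: frechet_derivative_slice_snd[OF d])
  qed
  ultimately show ?case by (simp add: differentiable_on_def)
qed

text \<open>
  The slice is supported in the projection of a closed slice of the compact support of \<open>\<Phi>\<close>, and this projection is compact.
\<close>

lemma test_functions_slice_fst:
  assumes "\<Phi> \<in> test_functions (A \<times> B)"
  shows "(\<lambda>x. \<Phi> (x, y)) \<in> test_functions A"
proof -
  let ?K = "closure {p. \<Phi> p \<noteq> 0}"
  note T = test_functionsD[OF assms]
  have sub: "{x. \<Phi> (x, y) \<noteq> 0} \<subseteq> fst ` (?K \<inter> UNIV \<times> {y})"
    using closure_subset[of "{p. \<Phi> p \<noteq> 0}"] by force
  have K: "compact (fst ` (?K \<inter> UNIV \<times> {y}))"
    by (intro compact_continuous_image continuous_intros compact_Int_closed T closed_Times closed_UNIV closed_singleton)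
  have cl: "closure {x. \<Phi> (x, y) \<noteq> 0} \<subseteq> fst ` (?K \<inter> UNIV \<times> {y})"
    by (rule closure_minimal[OF sub compact_imp_closed[OF K]])
  also have "\<dots> \<subseteq> A" using T(6) by auto
  finally have "closure {x. \<Phi> (x, y) \<noteq> 0} \<subseteq> A" .
  moreover have "compact (closure {x. \<Phi> (x, y) \<noteq> 0})"
    using compact_Int_closed[OF K closed_closure, of "{x. \<Phi> (x, y) \<noteq> 0}"] cl by (simp add: Int_absorb1)
  moreover have "C_k k (\<lambda>x. \<Phi> (x, y))" for k
    using assms by (intro C_k_slice_fst) (simp add: test_functions_def)
  ultimately show ?thesis by (simp add: test_functions_def)
qed

lemma test_functions_slice_snd:
  assumes "\<Phi> \<in> test_functions (A \<times> B)"
  shows "(\<lambda>y. \<Phi> (x, y)) \<in> test_functions B"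
proof -
  let ?K = "closure {p. \<Phi> p \<noteq> 0}"
  note T = test_functionsD[OF assms]
  have sub: "{y. \<Phi> (x, y) \<noteq> 0} \<subseteq> snd ` (?K \<inter> {x} \<times> UNIV)"
    using closure_subset[of "{p. \<Phi> p \<noteq> 0}"] by force
  have K: "compact (snd ` (?K \<inter> {x} \<times> UNIV))"
    by (intro compact_continuous_image continuous_intros compact_Int_closed T closed_Times closed_UNIV closed_singleton)
  have cl: "closure {y. \<Phi> (x, y) \<noteq> 0} \<subseteq> snd ` (?K \<inter> {x} \<times> UNIV)"
    by (rule closure_minimal[OF sub compact_imp_closed[OF K]])
  also have "\<dots> \<subseteq> B" using T(6) by auto
  finally have "closure {y. \<Phi> (x, y) \<noteq> 0} \<subseteq> B" .
  moreover have "compact (closure {y. \<Phi> (x, y) \<noteq> 0})"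
    using compact_Int_closed[OF K closed_closure, of "{y. \<Phi> (x, y) \<noteq> 0}"] cl by (simp add: Int_absorb1)
  moreover have "C_k k (\<lambda>y. \<Phi> (x, y))" for k
    using assms by (intro C_k_slice_snd) (simp add: test_functions_def)
  ultimately show ?thesis by (simp add: test_functions_def)
qed

lemma has_derivative_tensor:
  assumes "(f has_derivative D) (at x)" "(g has_derivative E) (at y)"
  shows "(tensor f g has_derivative (\<lambda>h. f x * E (snd h) + D (fst h) * g y)) (at (x, y))"
proof -
  have 1: "((\<lambda>p. f (fst p)) has_derivative (\<lambda>h. D (fst h))) (at (x, y))"
    by (rule has_derivative_compose[of fst fst "(x, y)" UNIV f]) (use assms in \<open>auto intro!: derivative_eq_intros\<close>)
  have 2: "((\<lambda>p. g (snd p)) has_derivative (\<lambda>h. E (snd h))) (at (x, y))"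
    by (rule has_derivative_compose[of snd snd "(x, y)" UNIV g]) (use assms in \<open>auto intro!: derivative_eq_intros\<close>)
  have "tensor f g = (\<lambda>p. f (fst p) * g (snd p))" by (auto simp: tensor_def)
  then show ?thesis using has_derivative_mult[OF 1 2] by simp
qed

lemma frechet_derivative_tensor:
  assumes "f differentiable at x" "g differentiable at y"
  shows "frechet_derivative (tensor f g) (at (x, y)) =
    (\<lambda>h. f x * frechet_derivative g (at y) (snd h) + frechet_derivative f (at x) (fst h) * g y)"
  using assms unfolding frechet_derivative_works
  by (intro frechet_derivative_at[symmetric] has_derivative_tensor)

text \<open>
  The assumption for all orders makes the induction go through: a partial derivative of \<open>f \<otimes> g\<close> is the tensor product of a
  partial derivative of one factor with the other factor, again of this form.
\<close>

lemma C_k_tensor: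
  fixes f :: "'a::euclidean_space \<Rightarrow> real" and g :: "'b::euclidean_space \<Rightarrow> real"
  assumes "\<And>k. C_k k f" "\<And>k. C_k k g"
  shows "C_k k (tensor f g)"
  using assms
proof (induction k arbitrary: f g)
  case 0
  have "tensor f g = (\<lambda>p. f (fst p) * g (snd p))" by (auto simp: tensor_def)
  then show ?case using 0(1)[of 0] 0(2)[of 0]
    by (auto intro!: continuous_intros continuous_on_compose2[of UNIV f] continuous_on_compose2[of UNIV g])
next
  case (Suc k)
  have f: "f differentiable at x" for x using Suc.prems(1)[of 1] by (simp add: differentiable_on_def)
  have g: "g differentiable at y" for y using Suc.prems(2)[of 1] by (simp add: differentiable_on_def)
  have "tensor f g differentiable at p" for p
    using has_derivative_tensor[OF f[THEN frechet_derivative_works[THEN iffD1]]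
        g[THEN frechet_derivative_works[THEN iffD1]], of "fst p" "snd p"]
    by (auto intro: differentiableI)
  moreover have "C_k k (\<lambda>p. frechet_derivative (tensor f g) (at p) b)" if "b \<in> Basis" for b
  proof -
    have fr: "frechet_derivative (tensor f g) (at p) b =
      f (fst p) * frechet_derivative g (at (snd p)) (snd b) +
      frechet_derivative f (at (fst p)) (fst b) * g (snd p)" for p
      using frechet_derivative_tensor[OF f g, of "fst p" "snd p"] by simp
    have lf: "frechet_derivative f (at x) 0 = 0" for x using f linear_frechet_derivative linear_0 by blast
    have lg: "frechet_derivative g (at y) 0 = 0" for y using g linear_frechet_derivative linear_0 by blast
    from that consider b1 where "b1 \<in> Basis" "b = (b1, 0)" | b2 where "b2 \<in> Basis" "b = (0, b2)"
      by (auto simp: Basis_prod_def)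
    then show ?thesis
    proof cases
      case 1
      have "C_k j (\<lambda>x. frechet_derivative f (at x) b1)" for j
        using Suc.prems(1)[of "Suc j"] 1 by simp
      from Suc.IH[OF this Suc.prems(2)] show ?thesis
        unfolding fr by (simp add: 1 lg tensor_def case_prod_beta')
    next
      case 2
      have "C_k j (\<lambda>y. frechet_derivative g (at y) b2)" for j
        using Suc.prems(2)[of "Suc j"] 2 by simp
      from Suc.IH[OF Suc.prems(1) this] show ?thesis
        unfolding fr by (simp add: 2 lf tensor_def case_prod_beta')
    qed
  qed
  ultimately show ?case by (simp add: differentiable_on_def)
qed

lemma test_functions_tensor:
  assumes "\<phi> \<in> test_functions A" "\<psi> \<in> test_functions B"
  shows "tensor \<phi> \<psi> \<in> test_functions (A \<times> B)"
proof -
  have "{p. tensor \<phi> \<psi> p \<noteq> 0} = {x. \<phi> x \<noteq> 0} \<times> {y. \<psi> y \<noteq> 0}"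
    by (auto simp: tensor_def)
  then have "closure {p. tensor \<phi> \<psi> p \<noteq> 0} = closure {x. \<phi> x \<noteq> 0} \<times> closure {y. \<psi> y \<noteq> 0}"
    by (simp add: closure_Times)
  moreover have "compact (closure {x. \<phi> x \<noteq> 0} \<times> closure {y. \<psi> y \<noteq> 0})"
    by (intro compact_Times test_functions_compact[OF assms(1)] test_functions_compact[OF assms(2)])
  ultimately show ?thesis
    using assms by (auto simp: test_functions_def C_k_tensor simp del: compact_closure)
qed

section \<open>Weak gradients and density of test functions\<close>

lemma has_weak_gradientD:
  assumes "has_weak_gradient \<Omega> u g"
  shows has_weak_gradient_L2: "u \<in> L2 \<Omega>" "g \<in> L2 \<Omega>"
    and has_weak_gradient_by_parts: "\<phi> \<in> test_functions \<Omega> \<Longrightarrow> b \<in> Basis \<Longrightarrow>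
      (LINT x|lebesgue_on \<Omega>. u x * frechet_derivative \<phi> (at x) b) =
      - (LINT x|lebesgue_on \<Omega>. (g x \<bullet> b) * \<phi> x)"
  using assms by (auto simp: has_weak_gradient_def)

lemma has_weak_gradient_weak_gradient:
  assumes "u \<in> H1 \<Omega>"
  shows "has_weak_gradient \<Omega> u (weak_gradient \<Omega> u)"
proof -
  have "\<exists>g. has_weak_gradient \<Omega> u g" using assms by (simp add: H1_def)
  then show ?thesis unfolding weak_gradient_def by (rule someI_ex)
qed

lemma has_weak_gradient_diff:
  assumes \<Omega>: "\<Omega> \<in> sets lebesgue"
    and u: "has_weak_gradient \<Omega> u g" and v: "has_weak_gradient \<Omega> v h"
  shows "has_weak_gradient \<Omega> (\<lambda>x. u x - v x) (\<lambda>x. g x - h x)"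
  unfolding has_weak_gradient_def
proof (intro conjI ballI)
  note U = has_weak_gradientD[OF u] and V = has_weak_gradientD[OF v]
  show "(\<lambda>x. u x - v x) \<in> L2 \<Omega>" "(\<lambda>x. g x - h x) \<in> L2 \<Omega>"
    using U V by (auto intro: L2_diff)
  fix \<phi> :: "'a \<Rightarrow> real" and b :: 'a assume \<phi>: "\<phi> \<in> test_functions \<Omega>" and b: "b \<in> Basis"
  have d: "(\<lambda>x. frechet_derivative \<phi> (at x) b) \<in> L2 \<Omega>"
    using L2_component[OF classical_gradient_L2[OF \<Omega> \<phi>], of b] b
    by (simp add: classical_gradient_inner_Basis)
  have "integrable (lebesgue_on \<Omega>) (\<lambda>x. u x * frechet_derivative \<phi> (at x) b)"
    "integrable (lebesgue_on \<Omega>) (\<lambda>x. v x * frechet_derivative \<phi> (at x) b)"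
    "integrable (lebesgue_on \<Omega>) (\<lambda>x. (g x \<bullet> b) * \<phi> x)"
    "integrable (lebesgue_on \<Omega>) (\<lambda>x. (h x \<bullet> b) * \<phi> x)"
    using L2_inner_integrable[OF U(1) d] L2_inner_integrable[OF V(1) d]
      L2_inner_integrable[OF L2_component[OF U(2)] test_functions_L2[OF \<Omega> \<phi>], of b]
      L2_inner_integrable[OF L2_component[OF V(2)] test_functions_L2[OF \<Omega> \<phi>], of b]
    by simp_all
  then show "(LINT x|lebesgue_on \<Omega>. (u x - v x) * frechet_derivative \<phi> (at x) b) =
      - (LINT x|lebesgue_on \<Omega>. ((g x - h x) \<bullet> b) * \<phi> x)"
    using U(3)[OF \<phi> b] V(3)[OF \<phi> b] by (simp add: left_diff_distrib inner_diff_left)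
qed

text \<open>
  Only the zero function of \<open>L\<^sup>2\<close> is orthogonal to all test functions. This is the form in which the fundamental lemma of the calculus of
  variations is used below; it makes weak gradients unique.
\<close>

definition test_functions_total :: "'a::euclidean_space set \<Rightarrow> bool" where
  "test_functions_total \<Omega> \<longleftrightarrow>
     (\<forall>u\<in>L2 \<Omega>. (\<forall>\<phi>\<in>test_functions \<Omega>. L2_inner \<Omega> u \<phi> = 0) \<longrightarrow> (AE x in lebesgue_on \<Omega>. u x = 0))"

text \<open>
  The components of the difference of two weak gradients of \<open>u\<close> are orthogonal to all test functions.
\<close>

lemma has_weak_gradient_unique:
  assumes \<Omega>: "\<Omega> \<in> sets lebesgue" and tot: "test_functions_total \<Omega>"
    and g: "has_weak_gradient \<Omega> u g" and h: "has_weak_gradient \<Omega> u h"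
  shows "AE x in lebesgue_on \<Omega>. g x = h x"
proof -
  note G = has_weak_gradientD[OF g] and H = has_weak_gradientD[OF h]
  have "AE x in lebesgue_on \<Omega>. g x \<bullet> b = h x \<bullet> b" if b: "b \<in> Basis" for b
  proof -
    have gb: "(\<lambda>x. g x \<bullet> b) \<in> L2 \<Omega>" and hb: "(\<lambda>x. h x \<bullet> b) \<in> L2 \<Omega>"
      using G(2) H(2) by (auto intro: L2_component)
    have "L2_inner \<Omega> (\<lambda>x. g x \<bullet> b - h x \<bullet> b) \<phi> = 0" if \<phi>: "\<phi> \<in> test_functions \<Omega>" for \<phi>
      using L2_inner_diff_left[OF gb hb test_functions_L2[OF \<Omega> \<phi>]] G(3)[OF \<phi> b] H(3)[OF \<phi> b]
      by (simp add: L2_inner_def)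
    then have "AE x in lebesgue_on \<Omega>. g x \<bullet> b - h x \<bullet> b = 0"
      using tot L2_diff[OF gb hb] unfolding test_functions_total_def by blast
    then show ?thesis by simp
  qed
  then have "AE x in lebesgue_on \<Omega>. \<forall>b\<in>Basis. g x \<bullet> b = h x \<bullet> b"
    by (intro AE_finite_allI) auto
  then show ?thesis by eventually_elim (auto intro: euclidean_eqI)
qed

text \<open>
  The Dirichlet form may be computed with any weak gradients in place of the chosen ones.
\<close>

lemma grad_inner_eq:
  assumes \<Omega>: "\<Omega> \<in> sets lebesgue" and tot: "test_functions_total \<Omega>"
    and u: "has_weak_gradient \<Omega> u g" and v: "has_weak_gradient \<Omega> v h"
  shows "grad_inner \<Omega> u v = L2_inner \<Omega> g h"
proof -
  have u': "has_weak_gradient \<Omega> u (weak_gradient \<Omega> u)" and v': "has_weak_gradient \<Omega> v (weak_gradient \<Omega> v)"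
    by (rule has_weak_gradient_weak_gradient, use u v in \<open>auto simp: H1_def\<close>)+
  show ?thesis unfolding grad_inner_def
    by (intro L2_inner_cong_AE has_weak_gradient_unique[OF \<Omega> tot u' u] has_weak_gradient_unique[OF \<Omega> tot v' v]
        has_weak_gradient_L2(2)[OF u] has_weak_gradient_L2(2)[OF v]
        has_weak_gradient_L2(2)[OF u'] has_weak_gradient_L2(2)[OF v'])
qed

lemma H1_norm_square: "(H1_norm \<Omega> u)\<^sup>2 = L2_inner \<Omega> u u + grad_inner \<Omega> u u"
  by (simp add: H1_norm_def grad_inner_def L2_inner_self_nonneg)

lemma H1_norm_nonneg: "0 \<le> H1_norm \<Omega> u"
  by (simp add: H1_norm_def grad_inner_def L2_inner_self_nonneg)

lemma H01_approx:
  assumes "u \<in> H01 \<Omega>" "0 < \<epsilon>"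
  obtains \<phi> where "\<phi> \<in> test_functions \<Omega>"
    "L2_inner \<Omega> (\<lambda>x. u x - \<phi> x) (\<lambda>x. u x - \<phi> x) < \<epsilon>"
    "grad_inner \<Omega> (\<lambda>x. u x - \<phi> x) (\<lambda>x. u x - \<phi> x) < \<epsilon>"
proof -
  obtain \<phi> where \<phi>: "\<phi> \<in> test_functions \<Omega>" "H1_norm \<Omega> (\<lambda>x. u x - \<phi> x) < sqrt \<epsilon>"
    using assms unfolding H01_def mem_Collect_eq by (meson real_sqrt_gt_zero)
  have "(H1_norm \<Omega> (\<lambda>x. u x - \<phi> x))\<^sup>2 < (sqrt \<epsilon>)\<^sup>2"
    using \<phi>(2) by (intro power_strict_mono H1_norm_nonneg) auto
  then have "L2_inner \<Omega> (\<lambda>x. u x - \<phi> x) (\<lambda>x. u x - \<phi> x) +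
      grad_inner \<Omega> (\<lambda>x. u x - \<phi> x) (\<lambda>x. u x - \<phi> x) < \<epsilon>"
    using assms(2) by (simp add: H1_norm_square)
  moreover have "0 \<le> L2_inner \<Omega> (\<lambda>x. u x - \<phi> x) (\<lambda>x. u x - \<phi> x)"
    "0 \<le> grad_inner \<Omega> (\<lambda>x. u x - \<phi> x) (\<lambda>x. u x - \<phi> x)"
    by (simp_all add: grad_inner_def L2_inner_self_nonneg)
  ultimately show ?thesis using \<phi>(1) that by fastforce
qed

lemma H01_H1: "u \<in> H01 \<Omega> \<Longrightarrow> u \<in> H1 \<Omega>"
  by (simp add: H01_def)

lemma H01_L2: "u \<in> H01 \<Omega> \<Longrightarrow> u \<in> L2 \<Omega>"
  by (auto dest!: H01_H1 simp: H1_def has_weak_gradient_def)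

lemma H01_approx_gradient:
  assumes \<Omega>: "\<Omega> \<in> sets lebesgue" and tot: "test_functions_total \<Omega>"
    and u: "u \<in> H01 \<Omega>" and g: "has_weak_gradient \<Omega> u g" and \<epsilon>: "0 < \<epsilon>"
  obtains \<phi> where "\<phi> \<in> test_functions \<Omega>"
    "L2_inner \<Omega> (\<lambda>x. u x - \<phi> x) (\<lambda>x. u x - \<phi> x) < \<epsilon>"
    "L2_inner \<Omega> (\<lambda>x. g x - classical_gradient \<phi> x) (\<lambda>x. g x - classical_gradient \<phi> x) < \<epsilon>"
proof -
  obtain \<phi> where \<phi>: "\<phi> \<in> test_functions \<Omega>"
    "L2_inner \<Omega> (\<lambda>x. u x - \<phi> x) (\<lambda>x. u x - \<phi> x) < \<epsilon>"
    "grad_inner \<Omega> (\<lambda>x. u x - \<phi> x) (\<lambda>x. u x - \<phi> x) < \<epsilon>"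
    using H01_approx[OF u \<epsilon>] .
  note w = has_weak_gradient_diff[OF \<Omega> g test_functions_has_weak_gradient[OF \<Omega> \<phi>(1)]]
  show ?thesis using that \<phi> grad_inner_eq[OF \<Omega> tot w w] by simp
qed

lemma H01I:
  assumes \<Omega>: "\<Omega> \<in> sets lebesgue" and tot: "test_functions_total \<Omega>"
    and g: "has_weak_gradient \<Omega> u g"
    and approx: "\<And>\<epsilon>. 0 < \<epsilon> \<Longrightarrow> \<exists>\<phi>\<in>test_functions \<Omega>.
      L2_inner \<Omega> (\<lambda>x. u x - \<phi> x) (\<lambda>x. u x - \<phi> x) < \<epsilon> \<and>
      L2_inner \<Omega> (\<lambda>x. g x - classical_gradient \<phi> x) (\<lambda>x. g x - classical_gradient \<phi> x) < \<epsilon>"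
  shows "u \<in> H01 \<Omega>"
  unfolding H01_def
proof (intro CollectI conjI allI impI)
  show "u \<in> H1 \<Omega>" using g by (auto simp: H1_def)
  fix \<epsilon> :: real assume \<epsilon>: "0 < \<epsilon>"
  then obtain \<phi> where \<phi>: "\<phi> \<in> test_functions \<Omega>"
      "L2_inner \<Omega> (\<lambda>x. u x - \<phi> x) (\<lambda>x. u x - \<phi> x) < \<epsilon>\<^sup>2 / 2"
      "L2_inner \<Omega> (\<lambda>x. g x - classical_gradient \<phi> x) (\<lambda>x. g x - classical_gradient \<phi> x) < \<epsilon>\<^sup>2 / 2"
    using approx[of "\<epsilon>\<^sup>2 / 2"] by auto
  note w = has_weak_gradient_diff[OF \<Omega> g test_functions_has_weak_gradient[OF \<Omega> \<phi>(1)]]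
  have "(H1_norm \<Omega> (\<lambda>x. u x - \<phi> x))\<^sup>2 < \<epsilon>\<^sup>2"
    using \<phi>(2,3) grad_inner_eq[OF \<Omega> tot w w] unfolding H1_norm_square by linarith
  then have "H1_norm \<Omega> (\<lambda>x. u x - \<phi> x) < \<epsilon>"
    by (rule power_less_imp_less_base) (use \<epsilon> in simp)
  with \<phi>(1) show "\<exists>\<phi>\<in>test_functions \<Omega>. H1_norm \<Omega> (\<lambda>x. u x - \<phi> x) < \<epsilon>" by blast
qed

lemma L2_zero: "(\<lambda>x. 0) \<in> L2 \<Omega>"
  by (simp add: L2_def)

lemma test_functions_H01:
  assumes \<Omega>: "\<Omega> \<in> sets lebesgue" and tot: "test_functions_total \<Omega>"
    and \<phi>: "\<phi> \<in> test_functions \<Omega>"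
  shows "\<phi> \<in> H01 \<Omega>"
  by (rule H01I[OF \<Omega> tot test_functions_has_weak_gradient[OF \<Omega> \<phi>]], rule bexI[OF _ \<phi>])
    (simp add: L2_inner_def)

lemma le_mult_arbitrarily_small_imp_nonpos:
  fixes s C :: real
  assumes "0 \<le> C" and le: "\<And>\<epsilon>. 0 < \<epsilon> \<Longrightarrow> s \<le> C * \<epsilon>"
  shows "s \<le> 0"
proof (rule ccontr)
  assume "\<not> s \<le> 0"
  then have "s \<le> C * (s / (C + 1))" using assms by (intro le) auto
  also have "\<dots> < s" using \<open>\<not> s \<le> 0\<close> \<open>0 \<le> C\<close> by (simp add: field_simps)
  finally show False by simp
qed

text \<open>
  The orthogonal complement of \<open>u\<close> is closed.
\<close>

lemma L2_inner_eq_0_closure: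
  assumes u: "u \<in> L2 \<Omega>" and v: "v \<in> L2 \<Omega>"
    and approx: "\<And>\<epsilon>. 0 < \<epsilon> \<Longrightarrow> \<exists>w\<in>L2 \<Omega>. L2_inner \<Omega> u w = 0 \<and>
      L2_inner \<Omega> (\<lambda>x. v x - w x) (\<lambda>x. v x - w x) \<le> \<epsilon>"
  shows "L2_inner \<Omega> u v = 0"
proof -
  have "(L2_inner \<Omega> u v)\<^sup>2 \<le> L2_inner \<Omega> u u * \<epsilon>" if pos: "0 < \<epsilon>" for \<epsilon>
  proof -
    obtain w where w: "w \<in> L2 \<Omega>" "L2_inner \<Omega> u w = 0"
      "L2_inner \<Omega> (\<lambda>x. v x - w x) (\<lambda>x. v x - w x) \<le> \<epsilon>"
      using approx[OF pos] by blast
    have "L2_inner \<Omega> u v = L2_inner \<Omega> u (\<lambda>x. v x - w x)"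
      using L2_inner_diff_right[OF v w(1) u] w(2) by simp
    also have "\<dots>\<^sup>2 \<le> L2_inner \<Omega> u u * L2_inner \<Omega> (\<lambda>x. v x - w x) (\<lambda>x. v x - w x)"
      by (rule L2_inner_Cauchy_Schwarz[OF u L2_diff[OF v w(1)]])
    also have "\<dots> \<le> L2_inner \<Omega> u u * \<epsilon>"
      using w(3) by (intro mult_left_mono L2_inner_self_nonneg)
    finally show ?thesis .
  qed
  then have "(L2_inner \<Omega> u v)\<^sup>2 \<le> 0"
    by (rule le_mult_arbitrarily_small_imp_nonpos[OF L2_inner_self_nonneg])
  then show ?thesis by simp
qed

text \<open>
  All partial sums of the expansion of \<open>u\<close> vanish, so the remainder, which tends to \<open>0\<close> in norm, is always \<open>u\<close> itself.
\<close>

lemma L2_orthonormal_basis_total: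
  assumes e: "orthonormal_basis (L2 \<Omega>) (L2_inner \<Omega>) e" and u: "u \<in> L2 \<Omega>"
    and 0: "\<And>j. L2_inner \<Omega> u (e j) = 0"
  shows "AE x in lebesgue_on \<Omega>. u x = 0"
proof -
  have "(\<lambda>n::nat. sqrt (L2_inner \<Omega> u u)) \<longlonglongrightarrow> 0"
    using e u 0 unfolding orthonormal_basis_def by (auto simp: Let_def)
  then have "L2_inner \<Omega> u u = 0" by (simp add: LIMSEQ_const_iff)
  with u show ?thesis by (rule L2_inner_self_eq_0)
qed

text \<open>
  Functions in \<open>H\<^sub>0\<^sup>1\<close> are \<open>L\<^sup>2\<close> limits of test functions, so a function orthogonal to all test functions is orthogonal to the
  basis.
\<close>

lemma test_functions_total_if_H01_basis:
  assumes \<Omega>: "\<Omega> \<in> sets lebesgue" and e: "orthonormal_basis (L2 \<Omega>) (L2_inner \<Omega>) e"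
    and H: "\<And>j. e j \<in> H01 \<Omega>"
  shows "test_functions_total \<Omega>"
  unfolding test_functions_total_def
proof (intro ballI impI)
  fix u assume u: "u \<in> L2 \<Omega>" and 0: "\<forall>\<phi>\<in>test_functions \<Omega>. L2_inner \<Omega> u \<phi> = 0"
  have "L2_inner \<Omega> u (e j) = 0" for j
  proof (rule L2_inner_eq_0_closure[OF u H01_L2[OF H]])
    fix \<epsilon> :: real assume "0 < \<epsilon>"
    from H01_approx[OF H this, of j] obtain \<phi> where "\<phi> \<in> test_functions \<Omega>"
      "L2_inner \<Omega> (\<lambda>x. e j x - \<phi> x) (\<lambda>x. e j x - \<phi> x) < \<epsilon>" .
    then show "\<exists>w\<in>L2 \<Omega>. L2_inner \<Omega> u w = 0 \<and>
      L2_inner \<Omega> (\<lambda>x. e j x - w x) (\<lambda>x. e j x - w x) \<le> \<epsilon>"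
      using 0 by (intro bexI[of _ \<phi>]) (auto intro: test_functions_L2[OF \<Omega>])
  qed
  then show "AE x in lebesgue_on \<Omega>. u x = 0" by (rule L2_orthonormal_basis_total[OF e u])
qed

text \<open>
  For each \<open>j\<close>, the coefficient \<open>h\<^sub>j(y) = \<integral> G(x, y) e\<^sub>j(x) dx\<close> is an \<open>L\<^sup>2\<close> function of \<open>y\<close> that is orthogonal to every \<open>f\<^sub>k\<close>, hence zero for
  almost every \<open>y\<close>. As there are countably many \<open>j\<close>, for almost every \<open>y\<close> all coefficients of \<open>G(\<cdot>, y)\<close> vanish at once, and so
  does \<open>G(\<cdot>, y)\<close>. Finite measure puts the constant function \<open>1\<close> into \<open>L\<^sup>2\<close>, which makes \<open>G(x, y) e\<^sub>j(x)\<close> integrable on the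
  product, so that Fubini gives measurability of \<open>h\<^sub>j\<close>.
\<close>

lemma tensor_basis_total:
  fixes A :: "'a::euclidean_space set" and B :: "'b::euclidean_space set"
  assumes A: "A \<in> lmeasurable" and B: "B \<in> lmeasurable"
    and e: "orthonormal_basis (L2 A) (L2_inner A) e" and f: "orthonormal_basis (L2 B) (L2_inner B) f"
    and G: "G \<in> L2 (A \<times> B)" and 0: "\<And>j k. L2_inner (A \<times> B) G (tensor (e j) (f k)) = 0"
  shows "AE p in lebesgue_on (A \<times> B). G p = 0"
proof -
  have sA: "A \<in> sets lebesgue" and sB: "B \<in> sets lebesgue" using A B by auto
  have eL: "e j \<in> L2 A" and fL: "f k \<in> L2 B" for j k
    using e f by (auto simp: orthonormal_basis_def)
  have e1: "L2_inner A (e j) (e j) = 1" for j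
    using e by (simp add: orthonormal_basis_def)
  have oA: "(\<lambda>_. 1 :: real) \<in> L2 A" and oB: "(\<lambda>_. 1 :: real) \<in> L2 B"
    using A B by (auto simp: L2_def integrable_restrict_space fmeasurable_def)
  define h where "h j y = (LINT x|lebesgue_on A. G (x, y) * e j x)" for j y
  have GG: "integrable (lebesgue_on (A \<times> B)) (\<lambda>p. G p * G p)"
    using L2_inner_self_integrable[OF G] by simp
  have sec: "AE y in lebesgue_on B. (\<lambda>x. G (x, y)) \<in> L2 A"
  proof -
    have "integrable (lebesgue_on (A \<times> B)) G"
      using L2_inner_integrable[OF G L2_tensor(1)[OF sA sB oA oB]] by (simp add: tensor_def case_prod_unfold)
    from Fubini_lebesgue_on(1)[OF sA sB this] Fubini_lebesgue_on(1)[OF sA sB GG]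
    show ?thesis
      by eventually_elim (auto simp: L2_def power2_eq_square dest: borel_measurable_integrable)
  qed
  have hz: "AE y in lebesgue_on B. h j y = 0" for j
  proof -
    have i: "integrable (lebesgue_on (A \<times> B)) (\<lambda>p. G p * e j (fst p))"
      using L2_inner_integrable[OF G L2_tensor(1)[OF sA sB eL[of j] oB]]
      by (simp add: tensor_def case_prod_unfold)
    have hm: "h j \<in> borel_measurable (lebesgue_on B)"
      using Fubini_lebesgue_on(2)[OF sA sB i] unfolding h_def by (auto dest: borel_measurable_integrable)
    \<comment> \<open>Cauchy--Schwarz on the slice, where \<open>e j\<close> has norm \<open>1\<close>, bounds \<open>h j\<close> by an \<open>L\<^sup>2\<close> function.\<close>
    have le: "AE y in lebesgue_on B. (h j y)\<^sup>2 \<le> (LINT x|lebesgue_on A. G (x, y) * G (x, y))"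
      using sec
    proof eventually_elim
      case (elim y)
      show ?case
        using L2_inner_Cauchy_Schwarz[OF elim eL[of j]] e1[of j]
        by (simp add: h_def L2_inner_def)
    qed
    have hL: "h j \<in> L2 B"
    proof -
      have "integrable (lebesgue_on B) (\<lambda>y. (h j y)\<^sup>2)"
        by (rule Bochner_Integration.integrable_bound[OF Fubini_lebesgue_on(2)[OF sA sB GG]])
          (use hm le in \<open>auto elim!: eventually_mono\<close>)
      then show ?thesis using hm by (simp add: L2_def)
    qed
    have "L2_inner B (h j) (f k) = 0" for k
    proof -
      have "integrable (lebesgue_on (A \<times> B)) (\<lambda>p. G p * tensor (e j) (f k) p)"
        using L2_inner_integrable[OF G L2_tensor(1)[OF sA sB eL fL], of j k] by simp
      from Fubini_lebesgue_on(3)[OF sA sB this]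
      have "(LINT y|lebesgue_on B. LINT x|lebesgue_on A. G (x, y) * e j x * f k y) = 0"
        using 0[of j k] by (simp add: L2_inner_def tensor_def mult.assoc)
      then show ?thesis by (simp add: L2_inner_def h_def)
    qed
    then show ?thesis by (rule L2_orthonormal_basis_total[OF f hL])
  qed
  then have "AE y in lebesgue_on B. \<forall>j. h j y = 0" by (simp add: AE_all_countable)
  with sec have "AE y in lebesgue_on B. (LINT x|lebesgue_on A. G (x, y) * G (x, y)) = 0"
  proof eventually_elim
    case (elim y)
    have "AE x in lebesgue_on A. G (x, y) = 0"
      by (rule L2_orthonormal_basis_total[OF e elim(1)]) (use elim(2) in \<open>simp add: L2_inner_def h_def\<close>)
    then have "AE x in lebesgue_on A. G (x, y) * G (x, y) = 0" by eventually_elim simp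
    then show ?case by (rule integral_eq_zero_AE)
  qed
  then have "(LINT y|lebesgue_on B. LINT x|lebesgue_on A. G (x, y) * G (x, y)) = 0"
    by (rule integral_eq_zero_AE)
  then have "L2_inner (A \<times> B) G G = 0"
    using Fubini_lebesgue_on(3)[OF sA sB GG] by (simp add: L2_inner_def)
  with G show ?thesis by (rule L2_inner_self_eq_0)
qed

section \<open>Tensor products of Sobolev functions\<close>

lemma tensor_apply: "tensor f g p = f (fst p) * g (snd p)"
  by (simp add: tensor_def case_prod_unfold)

text \<open>
  Orthogonality to all \<open>\<phi> \<otimes> \<psi>\<close> with test functions \<open>\<phi>\<close>, \<open>\<psi>\<close> is transferred to all \<open>e\<^sub>j \<otimes> f\<^sub>k\<close> by replacing first \<open>\<psi>\<close> by \<open>f\<^sub>k\<close>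
  and then \<open>\<phi>\<close> by \<open>e\<^sub>j\<close>.
\<close>

lemma test_functions_total_Times:
  fixes A :: "'a::euclidean_space set" and B :: "'b::euclidean_space set"
  assumes A: "A \<in> lmeasurable" and B: "B \<in> lmeasurable"
    and e: "orthonormal_basis (L2 A) (L2_inner A) e" and eH: "\<And>j. e j \<in> H01 A"
    and f: "orthonormal_basis (L2 B) (L2_inner B) f" and fH: "\<And>k. f k \<in> H01 B"
  shows "test_functions_total (A \<times> B)"
  unfolding test_functions_total_def
proof (intro ballI impI)
  fix G assume G: "G \<in> L2 (A \<times> B)" and 0: "\<forall>\<Phi>\<in>test_functions (A \<times> B). L2_inner (A \<times> B) G \<Phi> = 0"
  have sA: "A \<in> sets lebesgue" and sB: "B \<in> sets lebesgue" using A B by auto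
  have step1: "L2_inner (A \<times> B) G (tensor \<phi> (f k)) = 0" if \<phi>: "\<phi> \<in> test_functions A" for \<phi> k
  proof (rule L2_inner_eq_0_closure[OF G])
    have \<phi>L: "\<phi> \<in> L2 A" by (rule test_functions_L2[OF sA \<phi>])
    show "tensor \<phi> (f k) \<in> L2 (A \<times> B)" by (rule L2_tensor(1)[OF sA sB \<phi>L H01_L2[OF fH]])
    fix \<epsilon> :: real assume \<epsilon>: "0 < \<epsilon>"
    define C where "C = L2_inner A \<phi> \<phi>"
    have C: "0 \<le> C" unfolding C_def by (rule L2_inner_self_nonneg)
    have "0 < \<epsilon> / (C + 1)" using \<epsilon> C by simp
    from H01_approx[OF fH this, of k] obtain \<psi> where \<psi>: "\<psi> \<in> test_functions B"
      "L2_inner B (\<lambda>y. f k y - \<psi> y) (\<lambda>y. f k y - \<psi> y) < \<epsilon> / (C + 1)" .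
    have \<psi>L: "\<psi> \<in> L2 B" by (rule test_functions_L2[OF sB \<psi>(1)])
    have "(\<lambda>p. tensor \<phi> (f k) p - tensor \<phi> \<psi> p) = tensor \<phi> (\<lambda>y. f k y - \<psi> y)"
      by (auto simp: tensor_apply algebra_simps)
    then have "L2_inner (A \<times> B) (\<lambda>p. tensor \<phi> (f k) p - tensor \<phi> \<psi> p) (\<lambda>p. tensor \<phi> (f k) p - tensor \<phi> \<psi> p)
        = C * L2_inner B (\<lambda>y. f k y - \<psi> y) (\<lambda>y. f k y - \<psi> y)"
      using L2_tensor(2)[OF sA sB \<phi>L L2_diff[OF H01_L2[OF fH] \<psi>L]] by (simp add: C_def)
    also have "\<dots> \<le> C * (\<epsilon> / (C + 1))" using \<psi>(2) C by (intro mult_left_mono) auto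
    also have "\<dots> \<le> \<epsilon>" using C \<epsilon> by (simp add: field_simps)
    finally show "\<exists>w\<in>L2 (A \<times> B). L2_inner (A \<times> B) G w = 0 \<and>
        L2_inner (A \<times> B) (\<lambda>p. tensor \<phi> (f k) p - w p) (\<lambda>p. tensor \<phi> (f k) p - w p) \<le> \<epsilon>"
      using 0 test_functions_tensor[OF \<phi> \<psi>(1)] L2_tensor(1)[OF sA sB \<phi>L \<psi>L] by blast
  qed
  have step2: "L2_inner (A \<times> B) G (tensor (e j) (f k)) = 0" for j k
  proof (rule L2_inner_eq_0_closure[OF G])
    show "tensor (e j) (f k) \<in> L2 (A \<times> B)" by (rule L2_tensor(1)[OF sA sB H01_L2[OF eH] H01_L2[OF fH]])
    fix \<epsilon> :: real assume \<epsilon>: "0 < \<epsilon>"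
    have C: "L2_inner B (f k) (f k) = 1" using f by (simp add: orthonormal_basis_def)
    from H01_approx[OF eH \<epsilon>, of j] obtain \<phi> where \<phi>: "\<phi> \<in> test_functions A"
      "L2_inner A (\<lambda>x. e j x - \<phi> x) (\<lambda>x. e j x - \<phi> x) < \<epsilon>" .
    have \<phi>L: "\<phi> \<in> L2 A" by (rule test_functions_L2[OF sA \<phi>(1)])
    have "(\<lambda>p. tensor (e j) (f k) p - tensor \<phi> (f k) p) = tensor (\<lambda>x. e j x - \<phi> x) (f k)"
      by (auto simp: tensor_apply algebra_simps)
    then have "L2_inner (A \<times> B) (\<lambda>p. tensor (e j) (f k) p - tensor \<phi> (f k) p)
        (\<lambda>p. tensor (e j) (f k) p - tensor \<phi> (f k) p) \<le> \<epsilon>"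
      using L2_tensor(2)[OF sA sB L2_diff[OF H01_L2[OF eH] \<phi>L] H01_L2[OF fH], of j k] C \<phi>(2) by simp
    then show "\<exists>w\<in>L2 (A \<times> B). L2_inner (A \<times> B) G w = 0 \<and>
        L2_inner (A \<times> B) (\<lambda>p. tensor (e j) (f k) p - w p) (\<lambda>p. tensor (e j) (f k) p - w p) \<le> \<epsilon>"
      using step1[OF \<phi>(1)] L2_tensor(1)[OF sA sB \<phi>L H01_L2[OF fH]] by blast
  qed
  show "AE p in lebesgue_on (A \<times> B). G p = 0"
    by (rule tensor_basis_total[OF A B e f G step2])
qed

text \<open>
  For a basis direction of the first factor, the weak derivative of \<open>e\<close> is tested against the slices \<open>\<Phi>(\<cdot>, y)\<close>, and Fubini
  integrates the resulting identities over \<open>y\<close>; the second factor is symmetric.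
\<close>

lemma has_weak_gradient_tensor:
  fixes A :: "'a::euclidean_space set" and B :: "'b::euclidean_space set"
  assumes A: "A \<in> sets lebesgue" and B: "B \<in> sets lebesgue"
    and e: "has_weak_gradient A e g" and f: "has_weak_gradient B f h"
  shows "has_weak_gradient (A \<times> B) (tensor e f) (tensor_gradient e f g h)"
  unfolding has_weak_gradient_def
proof (intro conjI ballI)
  note E = has_weak_gradientD[OF e] and F = has_weak_gradientD[OF f]
  show t: "tensor e f \<in> L2 (A \<times> B)" by (rule L2_tensor(1)[OF A B E(1) F(1)])
  show tg: "tensor_gradient e f g h \<in> L2 (A \<times> B)"
    by (rule L2_tensor_gradient(1)[OF A B E(1) F(1) E(2) F(2)])
  note AB = lebesgue_Times[OF A B]
  fix \<Phi> :: "'a \<times> 'b \<Rightarrow> real" and b :: "'a \<times> 'b"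
  assume \<Phi>: "\<Phi> \<in> test_functions (A \<times> B)" and b: "b \<in> Basis"
  note d = test_functions_differentiable[OF \<Phi>]
  have i1: "integrable (lebesgue_on (A \<times> B)) (\<lambda>p. tensor e f p * frechet_derivative \<Phi> (at p) b)"
    using L2_inner_integrable[OF t L2_component[OF classical_gradient_L2[OF AB \<Phi>], of b]] b
    by (simp add: classical_gradient_inner_Basis)
  have i2: "integrable (lebesgue_on (A \<times> B)) (\<lambda>p. (tensor_gradient e f g h p \<bullet> b) * \<Phi> p)"
    using L2_inner_integrable[OF L2_component[OF tg] test_functions_L2[OF AB \<Phi>], of b] by simp
  note F1 = Fubini_lebesgue_on[OF A B i1] and F2 = Fubini_lebesgue_on[OF A B i2]
  from b consider b1 where "b1 \<in> Basis" "b = (b1, 0)" | b2 where "b2 \<in> Basis" "b = (0, b2)"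
    by (auto simp: Basis_prod_def)
  then show "(LINT p|lebesgue_on (A \<times> B). tensor e f p * frechet_derivative \<Phi> (at p) b) =
      - (LINT p|lebesgue_on (A \<times> B). (tensor_gradient e f g h p \<bullet> b) * \<Phi> p)"
  proof cases
    case 1
    have "(LINT x|lebesgue_on A. tensor e f (x, y) * frechet_derivative \<Phi> (at (x, y)) b) =
        - (LINT x|lebesgue_on A. (tensor_gradient e f g h (x, y) \<bullet> b) * \<Phi> (x, y))" for y
    proof -
      have "(LINT x|lebesgue_on A. tensor e f (x, y) * frechet_derivative \<Phi> (at (x, y)) b) =
        (LINT x|lebesgue_on A. f y * (e x * frechet_derivative (\<lambda>x. \<Phi> (x, y)) (at x) b1))"
        unfolding frechet_derivative_slice_fst[OF d] by (simp add: 1 tensor_def mult_ac)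
      also have "\<dots> = f y * - (LINT x|lebesgue_on A. (g x \<bullet> b1) * \<Phi> (x, y))"
        using E(3)[OF test_functions_slice_fst[OF \<Phi>] 1(1), of y] by simp
      also have "\<dots> = - (LINT x|lebesgue_on A. f y * ((g x \<bullet> b1) * \<Phi> (x, y)))" by simp
      also have "\<dots> = - (LINT x|lebesgue_on A. (tensor_gradient e f g h (x, y) \<bullet> b) * \<Phi> (x, y))"
        by (simp add: 1 tensor_gradient_def mult_ac)
      finally show ?thesis .
    qed
    then show ?thesis unfolding F1(3)[symmetric] F2(3)[symmetric] by simp
  next
    case 2
    have "(LINT y|lebesgue_on B. tensor e f (x, y) * frechet_derivative \<Phi> (at (x, y)) b) =
        - (LINT y|lebesgue_on B. (tensor_gradient e f g h (x, y) \<bullet> b) * \<Phi> (x, y))" for x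
    proof -
      have "(LINT y|lebesgue_on B. tensor e f (x, y) * frechet_derivative \<Phi> (at (x, y)) b) =
        (LINT y|lebesgue_on B. e x * (f y * frechet_derivative (\<lambda>y. \<Phi> (x, y)) (at y) b2))"
        unfolding frechet_derivative_slice_snd[OF d] by (simp add: 2 tensor_def mult_ac)
      also have "\<dots> = e x * - (LINT y|lebesgue_on B. (h y \<bullet> b2) * \<Phi> (x, y))"
        using F(3)[OF test_functions_slice_snd[OF \<Phi>] 2(1), of x] by simp
      also have "\<dots> = - (LINT y|lebesgue_on B. e x * ((h y \<bullet> b2) * \<Phi> (x, y)))" by simp
      also have "\<dots> = - (LINT y|lebesgue_on B. (tensor_gradient e f g h (x, y) \<bullet> b) * \<Phi> (x, y))"
        by (simp add: 2 tensor_gradient_def mult_ac)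
      finally show ?thesis .
    qed
    then show ?thesis unfolding F1(6)[symmetric] F2(6)[symmetric] by simp
  qed
qed

lemma classical_gradient_Pair:
  assumes d: "\<Phi> differentiable at (x, y)"
  shows "classical_gradient \<Phi> (x, y) =
    (classical_gradient (\<lambda>x. \<Phi> (x, y)) x, classical_gradient (\<lambda>y. \<Phi> (x, y)) y)"
proof (rule prod_eqI)
  show "fst (classical_gradient \<Phi> (x, y)) =
      fst (classical_gradient (\<lambda>x. \<Phi> (x, y)) x, classical_gradient (\<lambda>y. \<Phi> (x, y)) y)"
  proof (rule euclidean_eqI)
    fix b :: 'a assume b: "b \<in> Basis"
    then have "(b, 0) \<in> (Basis :: ('a \<times> 'b) set)" by (auto simp: Basis_prod_def)
    from classical_gradient_inner_Basis[OF this, of \<Phi> "(x, y)"]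
    show "fst (classical_gradient \<Phi> (x, y)) \<bullet> b =
      fst (classical_gradient (\<lambda>x. \<Phi> (x, y)) x, classical_gradient (\<lambda>y. \<Phi> (x, y)) y) \<bullet> b"
      using b by (simp add: classical_gradient_inner_Basis frechet_derivative_slice_fst[OF d] inner_prod_def)
  qed
  show "snd (classical_gradient \<Phi> (x, y)) =
      snd (classical_gradient (\<lambda>x. \<Phi> (x, y)) x, classical_gradient (\<lambda>y. \<Phi> (x, y)) y)"
  proof (rule euclidean_eqI)
    fix b :: 'b assume b: "b \<in> Basis"
    then have "(0, b) \<in> (Basis :: ('a \<times> 'b) set)" by (auto simp: Basis_prod_def)
    from classical_gradient_inner_Basis[OF this, of \<Phi> "(x, y)"]
    show "snd (classical_gradient \<Phi> (x, y)) \<bullet> b =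
      snd (classical_gradient (\<lambda>x. \<Phi> (x, y)) x, classical_gradient (\<lambda>y. \<Phi> (x, y)) y) \<bullet> b"
      using b by (simp add: classical_gradient_inner_Basis frechet_derivative_slice_snd[OF d] inner_prod_def)
  qed
qed

lemma classical_gradient_tensor:
  fixes A :: "'a::euclidean_space set" and B :: "'b::euclidean_space set"
  assumes "\<phi> \<in> test_functions A" "\<psi> \<in> test_functions B"
  shows "classical_gradient (tensor \<phi> \<psi>) =
    tensor_gradient \<phi> \<psi> (classical_gradient \<phi>) (classical_gradient \<psi>)"
proof
  fix p :: "'a \<times> 'b"
  note d = test_functions_differentiable[OF test_functions_tensor[OF assms]]
  note d1 = test_functions_differentiable[OF assms(1)] and d2 = test_functions_differentiable[OF assms(2)]
  have l1: "frechet_derivative \<phi> (at x) 0 = 0" for x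
    using d1 linear_frechet_derivative linear_0 by blast
  have l2: "frechet_derivative \<psi> (at y) 0 = 0" for y
    using d2 linear_frechet_derivative linear_0 by blast
  obtain x y where p: "p = (x, y)" by force
  have "classical_gradient (\<lambda>x. tensor \<phi> \<psi> (x, y)) x = \<psi> y *\<^sub>R classical_gradient \<phi> x"
    unfolding classical_gradient_def frechet_derivative_slice_fst[OF d] frechet_derivative_tensor[OF d1 d2]
    by (simp add: l2 scaleR_sum_right mult.commute)
  moreover have "classical_gradient (\<lambda>y. tensor \<phi> \<psi> (x, y)) y = \<phi> x *\<^sub>R classical_gradient \<psi> y"
    unfolding classical_gradient_def frechet_derivative_slice_snd[OF d] frechet_derivative_tensor[OF d1 d2]
    by (simp add: l1 scaleR_sum_right)
  ultimately show "classical_gradient (tensor \<phi> \<psi>) p =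
    tensor_gradient \<phi> \<psi> (classical_gradient \<phi>) (classical_gradient \<psi>) p"
    unfolding p classical_gradient_Pair[OF d] tensor_gradient_def by simp
qed

text \<open>
  The parallelogram identity without the norm of the difference.
\<close>

lemma L2_inner_add_self_le:
  assumes u: "u \<in> L2 \<Omega>" and v: "v \<in> L2 \<Omega>"
  shows "L2_inner \<Omega> (\<lambda>x. u x + v x) (\<lambda>x. u x + v x) \<le> 2 * L2_inner \<Omega> u u + 2 * L2_inner \<Omega> v v"
proof -
  have "L2_inner \<Omega> (\<lambda>x. u x + v x) (\<lambda>x. u x + v x) + L2_inner \<Omega> (\<lambda>x. u x - v x) (\<lambda>x. u x - v x) =
      (LINT x|lebesgue_on \<Omega>. ((u x + v x) \<bullet> (u x + v x)) + ((u x - v x) \<bullet> (u x - v x)))"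
    unfolding L2_inner_def
    by (intro Bochner_Integration.integral_add[symmetric] L2_inner_self_integrable L2_add L2_diff u v)
  also have "\<dots> = (LINT x|lebesgue_on \<Omega>. 2 * (u x \<bullet> u x) + 2 * (v x \<bullet> v x))"
    by (simp add: inner_simps inner_commute)
  also have "\<dots> = 2 * L2_inner \<Omega> u u + 2 * L2_inner \<Omega> v v"
    using L2_inner_self_integrable[OF u] L2_inner_self_integrable[OF v] by (simp add: L2_inner_def)
  finally show ?thesis using L2_inner_self_nonneg[of \<Omega> "\<lambda>x. u x - v x"] by linarith
qed

text \<open>
  With test functions \<open>\<phi>\<close>, \<open>\<psi>\<close> close to \<open>e\<close>, \<open>f\<close> in \<open>H\<^sup>1\<close>, the error splits as
  \<open>e \<otimes> f - \<phi> \<otimes> \<psi> = (e - \<phi>) \<otimes> f + \<phi> \<otimes> (f - \<psi>)\<close>, and its gradient splits in the same way. First \<open>\<phi>\<close> is chosen according to the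
  \<open>H\<^sup>1\<close> norm of \<open>f\<close>, and only then \<open>\<psi>\<close> according to the \<open>H\<^sup>1\<close> norm of \<open>\<phi>\<close>, so that both terms are small.
\<close>

lemma H01_tensor:
  fixes A :: "'a::euclidean_space set" and B :: "'b::euclidean_space set"
  assumes A: "A \<in> sets lebesgue" and B: "B \<in> sets lebesgue"
    and totA: "test_functions_total A" and totB: "test_functions_total B"
    and totAB: "test_functions_total (A \<times> B)"
    and e: "e \<in> H01 A" and f: "f \<in> H01 B"
  shows "tensor e f \<in> H01 (A \<times> B)"
proof -
  define g h where "g = weak_gradient A e" and "h = weak_gradient B f"
  have g: "has_weak_gradient A e g" and h: "has_weak_gradient B f h"
    unfolding g_def h_def by (rule has_weak_gradient_weak_gradient H01_H1 e f)+
  note E = has_weak_gradientD[OF g] and F = has_weak_gradientD[OF h]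
  show ?thesis
  proof (rule H01I[OF lebesgue_Times[OF A B] totAB has_weak_gradient_tensor[OF A B g h]])
    fix \<epsilon> :: real assume \<epsilon>: "0 < \<epsilon>"
    define M where "M = L2_inner B f f + L2_inner B h h"
    have M: "0 \<le> M" "L2_inner B f f \<le> M" unfolding M_def by (simp_all add: L2_inner_self_nonneg)
    have "0 < \<epsilon> / (4 * (M + 1))" using \<epsilon> M by simp
    from H01_approx_gradient[OF A totA e g this] obtain \<phi> where \<phi>: "\<phi> \<in> test_functions A"
      "L2_inner A (\<lambda>x. e x - \<phi> x) (\<lambda>x. e x - \<phi> x) < \<epsilon> / (4 * (M + 1))"
      "L2_inner A (\<lambda>x. g x - classical_gradient \<phi> x) (\<lambda>x. g x - classical_gradient \<phi> x) < \<epsilon> / (4 * (M + 1))" .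
    define N where "N = L2_inner A \<phi> \<phi> + L2_inner A (classical_gradient \<phi>) (classical_gradient \<phi>)"
    have N: "0 \<le> N" "L2_inner A \<phi> \<phi> \<le> N" unfolding N_def by (simp_all add: L2_inner_self_nonneg)
    have "0 < \<epsilon> / (4 * (N + 1))" using \<epsilon> N by simp
    from H01_approx_gradient[OF B totB f h this] obtain \<psi> where \<psi>: "\<psi> \<in> test_functions B"
      "L2_inner B (\<lambda>x. f x - \<psi> x) (\<lambda>x. f x - \<psi> x) < \<epsilon> / (4 * (N + 1))"
      "L2_inner B (\<lambda>x. h x - classical_gradient \<psi> x) (\<lambda>x. h x - classical_gradient \<psi> x) < \<epsilon> / (4 * (N + 1))" .
    let ?e = "\<lambda>x. e x - \<phi> x" and ?f = "\<lambda>y. f y - \<psi> y"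
    let ?g = "\<lambda>x. g x - classical_gradient \<phi> x" and ?h = "\<lambda>y. h y - classical_gradient \<psi> y"
    note \<phi>L = test_functions_L2[OF A \<phi>(1)] classical_gradient_L2[OF A \<phi>(1)]
    note \<psi>L = test_functions_L2[OF B \<psi>(1)] classical_gradient_L2[OF B \<psi>(1)]
    note dL = L2_diff[OF E(1) \<phi>L(1)] L2_diff[OF E(2) \<phi>L(2)] L2_diff[OF F(1) \<psi>L(1)] L2_diff[OF F(2) \<psi>L(2)]
    note t1 = L2_tensor[OF A B dL(1) F(1)] and t2 = L2_tensor[OF A B \<phi>L(1) dL(3)]
    note g1 = L2_tensor_gradient[OF A B dL(1) F(1) dL(2) F(2)]
      and g2 = L2_tensor_gradient[OF A B \<phi>L(1) dL(3) \<phi>L(2) dL(4)]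
    \<comment> \<open>The factor \<open>4\<close> in both tolerances pays for the factor \<open>2\<close> that \<open>L2_inner_add_self_le\<close> puts on each of the two terms.\<close>
    have small: "2 * s + 2 * t < \<epsilon>" if "s \<le> \<epsilon> / (4 * (M + 1)) * M" "t \<le> \<epsilon> / (4 * (N + 1)) * N" for s t
    proof -
      have "\<epsilon> / (4 * (M + 1)) * M < \<epsilon> / 4" "\<epsilon> / (4 * (N + 1)) * N < \<epsilon> / 4"
        using \<epsilon> M N by (simp_all add: field_simps)
      with that show ?thesis by linarith
    qed
    have eq1: "(\<lambda>p. tensor e f p - tensor \<phi> \<psi> p) = (\<lambda>p. tensor ?e f p + tensor \<phi> ?f p)"
      by (auto simp: tensor_apply algebra_simps)
    have "L2_inner (A \<times> B) (\<lambda>p. tensor e f p - tensor \<phi> \<psi> p) (\<lambda>p. tensor e f p - tensor \<phi> \<psi> p) < \<epsilon>"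
      unfolding eq1
    proof (rule le_less_trans[OF L2_inner_add_self_le[OF t1(1) t2(1)] small])
      show "L2_inner (A \<times> B) (tensor ?e f) (tensor ?e f) \<le> \<epsilon> / (4 * (M + 1)) * M"
        unfolding t1(2) using \<phi>(2) M \<epsilon> by (intro mult_mono) (auto simp: L2_inner_self_nonneg)
      show "L2_inner (A \<times> B) (tensor \<phi> ?f) (tensor \<phi> ?f) \<le> \<epsilon> / (4 * (N + 1)) * N"
        unfolding t2(2) mult.commute[of "L2_inner A \<phi> \<phi>"]
        using \<psi>(2) N \<epsilon> by (intro mult_mono) (auto simp: L2_inner_self_nonneg)
    qed
    moreover
    have eq2: "(\<lambda>p. tensor_gradient e f g h p - classical_gradient (tensor \<phi> \<psi>) p) =
        (\<lambda>p. tensor_gradient ?e f ?g h p + tensor_gradient \<phi> ?f (classical_gradient \<phi>) ?h p)"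
      unfolding classical_gradient_tensor[OF \<phi>(1) \<psi>(1)]
      by (auto simp: tensor_gradient_def algebra_simps)
    have "L2_inner (A \<times> B) (\<lambda>p. tensor_gradient e f g h p - classical_gradient (tensor \<phi> \<psi>) p)
        (\<lambda>p. tensor_gradient e f g h p - classical_gradient (tensor \<phi> \<psi>) p) < \<epsilon>"
      unfolding eq2
    proof (rule le_less_trans[OF L2_inner_add_self_le[OF g1(1) g2(1)] small])
      have "L2_inner A ?g ?g * L2_inner B f f + L2_inner A ?e ?e * L2_inner B h h
          \<le> \<epsilon> / (4 * (M + 1)) * L2_inner B f f + \<epsilon> / (4 * (M + 1)) * L2_inner B h h"
        using \<phi>(2,3) by (intro add_mono mult_right_mono) (auto simp: L2_inner_self_nonneg)
      then show "L2_inner (A \<times> B) (tensor_gradient ?e f ?g h) (tensor_gradient ?e f ?g h) \<le> \<epsilon> / (4 * (M + 1)) * M"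
        unfolding g1(2) by (simp only: M_def distrib_left)
      have "L2_inner A (classical_gradient \<phi>) (classical_gradient \<phi>) * L2_inner B ?f ?f +
          L2_inner A \<phi> \<phi> * L2_inner B ?h ?h
          \<le> L2_inner A (classical_gradient \<phi>) (classical_gradient \<phi>) * (\<epsilon> / (4 * (N + 1))) +
          L2_inner A \<phi> \<phi> * (\<epsilon> / (4 * (N + 1)))"
        using \<psi>(2,3) by (intro add_mono mult_left_mono) (auto simp: L2_inner_self_nonneg)
      also have "\<dots> = \<epsilon> / (4 * (N + 1)) *
          (L2_inner A \<phi> \<phi> + L2_inner A (classical_gradient \<phi>) (classical_gradient \<phi>))"
        by (simp only: ring_distribs ac_simps)
      also have "\<dots> = \<epsilon> / (4 * (N + 1)) * N" by (simp only: N_def)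
      finally show "L2_inner (A \<times> B) (tensor_gradient \<phi> ?f (classical_gradient \<phi>) ?h)
          (tensor_gradient \<phi> ?f (classical_gradient \<phi>) ?h) \<le> \<epsilon> / (4 * (N + 1)) * N"
        unfolding g2(2) .
    qed
    ultimately show "\<exists>\<Phi>\<in>test_functions (A \<times> B).
      L2_inner (A \<times> B) (\<lambda>p. tensor e f p - \<Phi> p) (\<lambda>p. tensor e f p - \<Phi> p) < \<epsilon> \<and>
      L2_inner (A \<times> B) (\<lambda>p. tensor_gradient e f g h p - classical_gradient \<Phi> p)
        (\<lambda>p. tensor_gradient e f g h p - classical_gradient \<Phi> p) < \<epsilon>"
      using test_functions_tensor[OF \<phi>(1) \<psi>(1)] by blast
  qed
qed

text \<open>
  The defect \<open>D\<close> of the equation at \<open>h\<close> is its defect at \<open>h - \<phi>\<close> for every test function \<open>\<phi>\<close>, and by Cauchy--Schwarz \<open>D\<^sup>2\<close> is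
  bounded by a constant times the squared \<open>H\<^sup>1\<close> distance of \<open>h\<close> and \<open>\<phi>\<close>.
\<close>

lemma weak_equation_density:
  assumes \<Omega>: "\<Omega> \<in> sets lebesgue" and tot: "test_functions_total \<Omega>"
    and g: "has_weak_gradient \<Omega> u g" and h: "h \<in> H01 \<Omega>"
    and eq: "\<And>\<phi>. \<phi> \<in> test_functions \<Omega> \<Longrightarrow> L2_inner \<Omega> g (classical_gradient \<phi>) = \<mu> * L2_inner \<Omega> u \<phi>"
  shows "grad_inner \<Omega> u h = \<mu> * L2_inner \<Omega> u h"
proof -
  define k where "k = weak_gradient \<Omega> h"
  have k: "has_weak_gradient \<Omega> h k"
    unfolding k_def by (rule has_weak_gradient_weak_gradient[OF H01_H1[OF h]])
  note U = has_weak_gradientD[OF g] and H = has_weak_gradientD[OF k]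
  define D where "D = L2_inner \<Omega> g k - \<mu> * L2_inner \<Omega> u h"
  define C where "C = 2 * L2_inner \<Omega> g g + 2 * \<mu>\<^sup>2 * L2_inner \<Omega> u u"
  have "D\<^sup>2 \<le> C * \<epsilon>" if \<epsilon>: "0 < \<epsilon>" for \<epsilon>
  proof -
    obtain \<phi> where \<phi>: "\<phi> \<in> test_functions \<Omega>"
      "L2_inner \<Omega> (\<lambda>x. h x - \<phi> x) (\<lambda>x. h x - \<phi> x) < \<epsilon>"
      "L2_inner \<Omega> (\<lambda>x. k x - classical_gradient \<phi> x) (\<lambda>x. k x - classical_gradient \<phi> x) < \<epsilon>"
      using H01_approx_gradient[OF \<Omega> tot h k \<epsilon>] .
    note \<phi>L = test_functions_L2[OF \<Omega> \<phi>(1)] classical_gradient_L2[OF \<Omega> \<phi>(1)]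
    define a b where "a = L2_inner \<Omega> g (\<lambda>x. k x - classical_gradient \<phi> x)"
      and "b = L2_inner \<Omega> u (\<lambda>x. h x - \<phi> x)"
    have D: "D = a - \<mu> * b"
      using eq[OF \<phi>(1)] by (simp add: D_def a_def b_def L2_inner_diff_right U H \<phi>L algebra_simps)
    have "a\<^sup>2 \<le> L2_inner \<Omega> g g * \<epsilon>"
      unfolding a_def
      by (rule order_trans[OF L2_inner_Cauchy_Schwarz[OF U(2) L2_diff[OF H(2) \<phi>L(2)]]
            mult_left_mono[OF less_imp_le[OF \<phi>(3)] L2_inner_self_nonneg]])
    moreover have "b\<^sup>2 \<le> L2_inner \<Omega> u u * \<epsilon>"
      unfolding b_def
      by (rule order_trans[OF L2_inner_Cauchy_Schwarz[OF U(1) L2_diff[OF H(1) \<phi>L(1)]]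
            mult_left_mono[OF less_imp_le[OF \<phi>(2)] L2_inner_self_nonneg]])
    then have "\<mu>\<^sup>2 * b\<^sup>2 \<le> \<mu>\<^sup>2 * (L2_inner \<Omega> u u * \<epsilon>)" by (rule mult_left_mono) simp
    moreover have "(a - \<mu> * b)\<^sup>2 \<le> 2 * a\<^sup>2 + 2 * (\<mu>\<^sup>2 * b\<^sup>2)"
      using zero_le_power2[of "a + \<mu> * b"] by (simp add: power2_eq_square algebra_simps)
    ultimately have "D\<^sup>2 \<le> 2 * (L2_inner \<Omega> g g * \<epsilon>) + 2 * (\<mu>\<^sup>2 * (L2_inner \<Omega> u u * \<epsilon>))"
      unfolding D by linarith
    also have "\<dots> = C * \<epsilon>" by (simp add: C_def algebra_simps)
    finally show ?thesis .
  qed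
  moreover have "0 \<le> C" unfolding C_def by (simp add: L2_inner_self_nonneg)
  ultimately have "D\<^sup>2 \<le> 0" by (intro le_mult_arbitrarily_small_imp_nonpos[of C]) auto
  then have "D = 0" by simp
  then show ?thesis using grad_inner_eq[OF \<Omega> tot g k] by (simp add: D_def)
qed

text \<open>
  Separation of variables in weak form. The two components of the gradient are treated separately, each by
  integrating first over the variable in which it differentiates, where the weak equation of one factor applies to the slice.
\<close>

lemma weak_equation_tensor:
  fixes A :: "'a::euclidean_space set" and B :: "'b::euclidean_space set"
  assumes A: "A \<in> sets lebesgue" and B: "B \<in> sets lebesgue"
    and L: "e \<in> L2 A" "f \<in> L2 B" "g \<in> L2 A" "h \<in> L2 B"
    and e: "\<And>\<phi>. \<phi> \<in> test_functions A \<Longrightarrow> L2_inner A g (classical_gradient \<phi>) = \<mu> * L2_inner A e \<phi>"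
    and f: "\<And>\<psi>. \<psi> \<in> test_functions B \<Longrightarrow> L2_inner B h (classical_gradient \<psi>) = \<nu> * L2_inner B f \<psi>"
    and \<Phi>: "\<Phi> \<in> test_functions (A \<times> B)"
  shows "L2_inner (A \<times> B) (tensor_gradient e f g h) (classical_gradient \<Phi>) =
    (\<mu> + \<nu>) * L2_inner (A \<times> B) (tensor e f) \<Phi>"
proof -
  note AB = lebesgue_Times[OF A B]
  note \<Phi>L = test_functions_L2[OF AB \<Phi>] classical_gradient_L2[OF AB \<Phi>]
  have cg: "classical_gradient \<Phi> (x, y) =
    (classical_gradient (\<lambda>x. \<Phi> (x, y)) x, classical_gradient (\<lambda>y. \<Phi> (x, y)) y)" for x y
    by (rule classical_gradient_Pair[OF test_functions_differentiable[OF \<Phi>]])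
  \<comment> \<open>Each component is itself a tensor gradient with one gradient replaced by \<open>0\<close>; this shows at once that it is in \<open>L\<^sup>2\<close>.\<close>
  let ?G = "tensor_gradient e f g (\<lambda>_. 0)" and ?H = "tensor_gradient e f (\<lambda>_. 0) h"
  have GL: "?G \<in> L2 (A \<times> B)" and HL: "?H \<in> L2 (A \<times> B)"
    by (rule L2_tensor_gradient(1)[OF A B L(1,2)] L L2_zero)+
  have tL: "tensor e f \<in> L2 (A \<times> B)" by (rule L2_tensor(1)[OF A B L(1,2)])
  note FT = Fubini_lebesgue_on[OF A B L2_inner_integrable[OF tL \<Phi>L(1)]]
  have I: "(LINT x|lebesgue_on A. f y * (e x * \<Phi> (x, y))) = f y * L2_inner A e (\<lambda>x. \<Phi> (x, y))" for y
    by (simp add: L2_inner_def)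
  have J: "(LINT y|lebesgue_on B. e x * (f y * \<Phi> (x, y))) = e x * L2_inner B f (\<lambda>y. \<Phi> (x, y))" for x
    by (simp add: L2_inner_def)
  have "L2_inner (A \<times> B) ?G (classical_gradient \<Phi>) =
      (LINT y|lebesgue_on B. LINT x|lebesgue_on A. ?G (x, y) \<bullet> classical_gradient \<Phi> (x, y))"
    unfolding L2_inner_def using Fubini_lebesgue_on(3)[OF A B L2_inner_integrable[OF GL \<Phi>L(2)]] by simp
  also have "\<dots> = (LINT y|lebesgue_on B. f y * L2_inner A g (classical_gradient (\<lambda>x. \<Phi> (x, y))))"
    by (simp add: tensor_gradient_def cg L2_inner_def)
  also have "\<dots> = (LINT y|lebesgue_on B. f y * (\<mu> * L2_inner A e (\<lambda>x. \<Phi> (x, y))))"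
    by (simp only: e[OF test_functions_slice_fst[OF \<Phi>]])
  also have "\<dots> = (LINT y|lebesgue_on B. \<mu> * (LINT x|lebesgue_on A. f y * (e x * \<Phi> (x, y))))"
    unfolding I by (simp only: mult.left_commute)
  also have "\<dots> = \<mu> * (LINT y|lebesgue_on B. LINT x|lebesgue_on A. tensor e f (x, y) \<bullet> \<Phi> (x, y))"
    by (simp add: tensor_def mult_ac)
  also have "\<dots> = \<mu> * L2_inner (A \<times> B) (tensor e f) \<Phi>"
    unfolding L2_inner_def FT(3) ..
  finally have 1: "L2_inner (A \<times> B) ?G (classical_gradient \<Phi>) = \<mu> * L2_inner (A \<times> B) (tensor e f) \<Phi>" .
  have "L2_inner (A \<times> B) ?H (classical_gradient \<Phi>) =
      (LINT x|lebesgue_on A. LINT y|lebesgue_on B. ?H (x, y) \<bullet> classical_gradient \<Phi> (x, y))"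
    unfolding L2_inner_def using Fubini_lebesgue_on(6)[OF A B L2_inner_integrable[OF HL \<Phi>L(2)]] by simp
  also have "\<dots> = (LINT x|lebesgue_on A. e x * L2_inner B h (classical_gradient (\<lambda>y. \<Phi> (x, y))))"
    by (simp add: tensor_gradient_def cg L2_inner_def)
  also have "\<dots> = (LINT x|lebesgue_on A. e x * (\<nu> * L2_inner B f (\<lambda>y. \<Phi> (x, y))))"
    by (simp only: f[OF test_functions_slice_snd[OF \<Phi>]])
  also have "\<dots> = (LINT x|lebesgue_on A. \<nu> * (LINT y|lebesgue_on B. e x * (f y * \<Phi> (x, y))))"
    unfolding J by (simp only: mult.left_commute)
  also have "\<dots> = \<nu> * (LINT x|lebesgue_on A. LINT y|lebesgue_on B. tensor e f (x, y) \<bullet> \<Phi> (x, y))"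
    by (simp add: tensor_def mult_ac)
  also have "\<dots> = \<nu> * L2_inner (A \<times> B) (tensor e f) \<Phi>"
    unfolding L2_inner_def FT(6) ..
  finally have 2: "L2_inner (A \<times> B) ?H (classical_gradient \<Phi>) = \<nu> * L2_inner (A \<times> B) (tensor e f) \<Phi>" .
  have "tensor_gradient e f g h p \<bullet> v = ?G p \<bullet> v + ?H p \<bullet> v" for p v
    by (simp add: tensor_gradient_def case_prod_unfold inner_prod_def)
  then have "L2_inner (A \<times> B) (tensor_gradient e f g h) (classical_gradient \<Phi>) =
      L2_inner (A \<times> B) ?G (classical_gradient \<Phi>) + L2_inner (A \<times> B) ?H (classical_gradient \<Phi>)"
    using L2_inner_integrable[OF GL \<Phi>L(2)] L2_inner_integrable[OF HL \<Phi>L(2)]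
    by (simp add: L2_inner_def)
  then show ?thesis unfolding 1 2 by (simp add: distrib_right)
qed

lemma dirichlet_eigenfunction_test:
  assumes \<Omega>: "\<Omega> \<in> sets lebesgue" and tot: "test_functions_total \<Omega>"
    and u: "dirichlet_eigenfunction \<Omega> \<mu> u" and \<phi>: "\<phi> \<in> test_functions \<Omega>"
  shows "L2_inner \<Omega> (weak_gradient \<Omega> u) (classical_gradient \<phi>) = \<mu> * L2_inner \<Omega> u \<phi>"
proof -
  have "u \<in> H01 \<Omega>" using u by (simp add: dirichlet_eigenfunction_def)
  then have g: "has_weak_gradient \<Omega> u (weak_gradient \<Omega> u)"
    by (intro has_weak_gradient_weak_gradient H01_H1)
  have "grad_inner \<Omega> u \<phi> = \<mu> * L2_inner \<Omega> u \<phi>"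
    using u test_functions_H01[OF \<Omega> tot \<phi>] by (simp add: dirichlet_eigenfunction_def)
  then show ?thesis
    using grad_inner_eq[OF \<Omega> tot g test_functions_has_weak_gradient[OF \<Omega> \<phi>]] by simp
qed

text \<open>
  The product does not vanish almost everywhere because its \<open>L\<^sup>2\<close> norm is the product of the norms of the factors.
\<close>

lemma dirichlet_eigenfunction_tensor:
  fixes A :: "'a::euclidean_space set" and B :: "'b::euclidean_space set"
  assumes A: "A \<in> sets lebesgue" and B: "B \<in> sets lebesgue"
    and totA: "test_functions_total A" and totB: "test_functions_total B"
    and totAB: "test_functions_total (A \<times> B)"
    and e: "dirichlet_eigenfunction A \<mu> e" and f: "dirichlet_eigenfunction B \<nu> f"
  shows "dirichlet_eigenfunction (A \<times> B) (\<mu> + \<nu>) (tensor e f)"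
proof -
  have eH: "e \<in> H01 A" and fH: "f \<in> H01 B"
    using e f by (auto simp: dirichlet_eigenfunction_def)
  note g = has_weak_gradient_weak_gradient[OF H01_H1[OF eH]]
    and h = has_weak_gradient_weak_gradient[OF H01_H1[OF fH]]
  note E = has_weak_gradientD[OF g] and F = has_weak_gradientD[OF h]
  have "\<not> (AE p in lebesgue_on (A \<times> B). tensor e f p = 0)"
  proof
    assume "AE p in lebesgue_on (A \<times> B). tensor e f p = 0"
    then have "AE p in lebesgue_on (A \<times> B). tensor e f p \<bullet> tensor e f p = 0"
      by eventually_elim simp
    then have "L2_inner (A \<times> B) (tensor e f) (tensor e f) = 0"
      unfolding L2_inner_def by (rule integral_eq_zero_AE)
    then have "L2_inner A e e = 0 \<or> L2_inner B f f = 0"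
      using L2_tensor(2)[OF A B E(1) F(1)] by simp
    then show False
      using L2_inner_self_eq_0[OF E(1)] L2_inner_self_eq_0[OF F(1)] e f
      by (auto simp: dirichlet_eigenfunction_def)
  qed
  moreover have "grad_inner (A \<times> B) (tensor e f) k = (\<mu> + \<nu>) * L2_inner (A \<times> B) (tensor e f) k"
    if "k \<in> H01 (A \<times> B)" for k
    by (rule weak_equation_density[OF lebesgue_Times[OF A B] totAB has_weak_gradient_tensor[OF A B g h] that],
        rule weak_equation_tensor[OF A B E(1) F(1) E(2) F(2)
          dirichlet_eigenfunction_test[OF A totA e] dirichlet_eigenfunction_test[OF B totB f]])
  ultimately show ?thesis
    using H01_tensor[OF A B totA totB totAB eH fH] by (simp add: dirichlet_eigenfunction_def)
qed

theorem theorem4p1: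
  fixes \<Omega>1 :: "'a::euclidean_space set" and \<Omega>2 :: "'b::euclidean_space set"
    and lam1 lam2 :: "nat \<Rightarrow> real"
    and e1 :: "nat \<Rightarrow> 'a \<Rightarrow> real" and e2 :: "nat \<Rightarrow> 'b \<Rightarrow> real"
  assumes "region \<Omega>1" and "condition_B1 \<Omega>1"
    and "region \<Omega>2" and "condition_B1 \<Omega>2"
    and "dirichlet_eigendata \<Omega>1 lam1 e1"
    and "dirichlet_eigendata \<Omega>2 lam2 e2"
  shows "\<forall>j k. dirichlet_eigenfunction (\<Omega>1 \<times> \<Omega>2) (lam1 j + lam2 k) (tensor (e1 j) (e2 k))"
proof -
  have m: "\<Omega>1 \<in> lmeasurable" "\<Omega>2 \<in> lmeasurable"
    using assms by (auto simp: region_def condition_B1_def intro: lmeasurable_open)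
  then have s: "\<Omega>1 \<in> sets lebesgue" "\<Omega>2 \<in> sets lebesgue" by auto
  have e: "dirichlet_eigenfunction \<Omega>1 (lam1 j) (e1 j)" "dirichlet_eigenfunction \<Omega>2 (lam2 j) (e2 j)" for j
    using assms by (auto simp: dirichlet_eigendata_def)
  then have H: "e1 j \<in> H01 \<Omega>1" "e2 j \<in> H01 \<Omega>2" for j
    by (auto simp: dirichlet_eigenfunction_def)
  have b: "orthonormal_basis (L2 \<Omega>1) (L2_inner \<Omega>1) e1" "orthonormal_basis (L2 \<Omega>2) (L2_inner \<Omega>2) e2"
    using assms by (auto simp: dirichlet_eigendata_def)
  show ?thesis
    by (intro allI dirichlet_eigenfunction_tensor[OF s] e
        test_functions_total_if_H01_basis[OF s(1) b(1) H(1)] test_functions_total_if_H01_basis[OF s(2) b(2) H(2)]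
        test_functions_total_Times[OF m b(1) H(1) b(2) H(2)])
qed

end
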